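(* Let $\mathcal M=(\mathcal H_A,\xi,\mathcal E,\mathsf Z)$ be a measurement scheme constrained by the third law. Suppose it implements an $\mathsf E$-instrument $\mathcal I$, where $\mathsf E$ is a non-trivial observable on $\mathcal H_S$. If $\mathcal I$ is extremal, then: (i) $\operatorname{rank}\mathsf E_x\ge\sqrt{\dim\mathcal H_S}$ for every $x\in\mathcal X$; (ii) $\mathcal E$ is not a unitary channel, i.e. there is no unitary $U$ on $\mathcal H_S\otimes\mathcal H_A$ with $\mathcal E(\cdot)=U\cdot U^*$.
   Context: All Hilbert spaces are finite-dimensional and complex. A state is a positive operator of unit trace; it is full-rank if it is positive definite. A channel is a completely positive trace-preserving linear map. A channel is constrained by the third law if it maps every full-rank state on its input space to a full-rank state on its output space. Let $2\le\dim\mathcal H_S<\infty$. An observable is a finite family $\mathsf E=\{\mathsf E_x\}_{x\in\mathcal X}$ of nonzero operators with $0\le\mathsf E_x\le\mathbb 1$ and $\sum_x\mathsf E_x=\mathbb 1$. It is non-trivial if some $\mathsf E_x$ is not a multiple of $\mathbb 1$. An $\mathsf E$-instrument is a family $\{\mathcal I_x\}_{x\in\mathcal X}$ of completely positive maps on $\mathcal L(\mathcal H_S)$ with $\mathrm{tr}[\mathcal I_x(\rho)]=\mathrm{tr}[\mathsf E_x\rho]$ for all $x$ and all states $\rho$. A measurement scheme $(\mathcal H_A,\xi,\mathcal E,\mathsf Z)$ consists of: - a finite-dimensional $\mathcal H_A$; - a state $\xi$ on $\mathcal H_A$; - a channel $\mathcal E$ on $\mathcal L(\mathcal H_S\otimes\mathcal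 H_A)$; - positive operators $\{\mathsf Z_x\}_{x\in\mathcal X}$ on $\mathcal H_A$ summing to $\mathbb 1$. It implements $\mathcal I_x(\rho)=\mathrm{tr}_A[(\mathbb 1\otimes\mathsf Z_x)\mathcal E(\rho\otimes\xi)]$. It is constrained by the third law if $\xi$ is full-rank and $\mathcal E$ is constrained by the third law. An instrument $\mathcal I$ with outcome set $\mathcal X$ is extremal if the following holds: whenever $\mathcal I_x=\lambda\mathcal I^{(1)}_x+(1-\lambda)\mathcal I^{(2)}_x$ for all $x$, with $\lambda\in(0,1)$ and $\mathcal I^{(1)},\mathcal I^{(2)}$ instruments with outcome set $\mathcal X$ (families of completely positive maps whose sum is trace-preserving), then $\mathcal I^{(1)}=\mathcal I^{(2)}=\mathcal I$. *)

theory Defs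
  imports "HOL-Analysis.Analysis"
begin

text \<open>Operators on a finite-dimensional Hilbert space \<open>\<complex>^'n\<close> are represented as
  matrices \<open>complex^'n^'n\<close>.  The tensor product \<open>H_S \<otimes> H_A\<close> is \<open>\<complex>^('s \<times> 'a)\<close>.\<close>

type_synonym 'n op = "complex^'n^'n"

definition adj :: "complex^'n^'m \<Rightarrow> complex^'m^'n" where
  "adj A = (\<chi> i j. cnj (A $ j $ i))"

definition op_smult :: "complex \<Rightarrow> complex^'n^'m \<Rightarrow> complex^'n^'m" where
  "op_smult c A = (\<chi> i j. c * A $ i $ j)"

definition qform :: "'n op \<Rightarrow> complex^'n \<Rightarrow> complex" where
  "qform A v = (\<Sum>i\<in>UNIV. cnj (v $ i) * (A *v v) $ i)"

definition positive_op :: "'n::finite op \<Rightarrow> bool" where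
  "positive_op A \<longleftrightarrow> (\<forall>v. Im (qform A v) = 0 \<and> Re (qform A v) \<ge> 0)"

definition positive_definite :: "'n::finite op \<Rightarrow> bool" where
  "positive_definite A \<longleftrightarrow> (\<forall>v. v \<noteq> 0 \<longrightarrow> Im (qform A v) = 0 \<and> Re (qform A v) > 0)"

definition is_state :: "'n::finite op \<Rightarrow> bool" where
  "is_state \<rho> \<longleftrightarrow> positive_op \<rho> \<and> trace \<rho> = 1"

definition full_rank_state :: "'n::finite op \<Rightarrow> bool" where
  "full_rank_state \<rho> \<longleftrightarrow> is_state \<rho> \<and> positive_definite \<rho>"

definition clinear_map :: "('n::finite op \<Rightarrow> 'm::finite op) \<Rightarrow> bool" where
  "clinear_map \<Phi> \<longleftrightarrow> (\<forall>X Y. \<Phi> (X + Y) = \<Phi> X + \<Phi> Y) \<and> (\<forall>c X. \<Phi> (op_smult c X) = op_smult c (\<Phi> X))"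

text \<open>Block operators on \<open>\<complex>^k \<otimes> H\<close>: blocks \<open>X a b\<close> for \<open>a, b < k\<close>.  Positivity of a block
  operator: \<open>\<Sum>_{a,b<k} \<langle>v_a, X_{ab} v_b\<rangle> \<ge> 0\<close> for all \<open>v_0,\<dots>,v_{k-1}\<close>.\<close>
definition block_qform :: "nat \<Rightarrow> (nat \<Rightarrow> nat \<Rightarrow> 'n op) \<Rightarrow> (nat \<Rightarrow> complex^'n) \<Rightarrow> complex" where
  "block_qform k X v = (\<Sum>a<k. \<Sum>b<k. \<Sum>i\<in>UNIV. cnj (v a $ i) * (X a b *v v b) $ i)"

definition block_positive :: "nat \<Rightarrow> (nat \<Rightarrow> nat \<Rightarrow> 'n::finite op) \<Rightarrow> bool" where
  "block_positive k X \<longleftrightarrow> (\<forall>v. Im (block_qform k X v) = 0 \<and> Re (block_qform k X v) \<ge> 0)"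

definition completely_positive :: "('n::finite op \<Rightarrow> 'm::finite op) \<Rightarrow> bool" where
  "completely_positive \<Phi> \<longleftrightarrow> clinear_map \<Phi> \<and>
     (\<forall>k X. block_positive k X \<longrightarrow> block_positive k (\<lambda>a b. \<Phi> (X a b)))"

definition is_channel :: "('n::finite op \<Rightarrow> 'm::finite op) \<Rightarrow> bool" where
  "is_channel \<Phi> \<longleftrightarrow> completely_positive \<Phi> \<and> (\<forall>X. trace (\<Phi> X) = trace X)"

definition third_law_channel :: "('n::finite op \<Rightarrow> 'm::finite op) \<Rightarrow> bool" where
  "third_law_channel \<Phi> \<longleftrightarrow> is_channel \<Phi> \<and> (\<forall>\<rho>. full_rank_state \<rho> \<longrightarrow> full_rank_state (\<Phi> \<rho>))"

definition is_observable :: "('x::finite \<Rightarrow> 'n::finite op) \<Rightarrow> bool" where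
  "is_observable E \<longleftrightarrow> (\<forall>x. E x \<noteq> 0 \<and> positive_op (E x) \<and> positive_op (mat 1 - E x))
      \<and> (\<Sum>x\<in>UNIV. E x) = mat 1"

definition nontrivial_observable :: "('x::finite \<Rightarrow> 'n::finite op) \<Rightarrow> bool" where
  "nontrivial_observable E \<longleftrightarrow> is_observable E \<and> (\<exists>x. \<not> (\<exists>c. E x = op_smult c (mat 1)))"

definition is_instrument :: "('x::finite \<Rightarrow> 'n::finite op \<Rightarrow> 'n op) \<Rightarrow> bool" where
  "is_instrument I \<longleftrightarrow> (\<forall>x. completely_positive (I x)) \<and> (\<forall>X. trace (\<Sum>x\<in>UNIV. I x X) = trace X)"

definition is_E_instrument :: "('x::finite \<Rightarrow> 'n::finite op) \<Rightarrow> ('x \<Rightarrow> 'n op \<Rightarrow> 'n op) \<Rightarrow> bool" where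
  "is_E_instrument E I \<longleftrightarrow> (\<forall>x. completely_positive (I x)) \<and>
     (\<forall>x \<rho>. is_state \<rho> \<longrightarrow> trace (I x \<rho>) = trace (E x ** \<rho>))"

definition extremal_instrument :: "('x::finite \<Rightarrow> 'n::finite op \<Rightarrow> 'n op) \<Rightarrow> bool" where
  "extremal_instrument I \<longleftrightarrow> (\<forall>t I1 I2. 0 < t \<and> t < 1 \<and> is_instrument I1 \<and> is_instrument I2 \<and>
      (\<forall>x X. I x X = op_smult (complex_of_real t) (I1 x X) + op_smult (complex_of_real (1 - t)) (I2 x X))
      \<longrightarrow> I1 = I \<and> I2 = I)"

definition tensor_op :: "'s::finite op \<Rightarrow> 'a::finite op \<Rightarrow> ('s \<times> 'a) op" where
  "tensor_op A B = (\<chi> p q. A $ fst p $ fst q * B $ snd p $ snd q)"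

definition ptrace_A :: "('s::finite \<times> 'a::finite) op \<Rightarrow> 's op" where
  "ptrace_A X = (\<chi> i k. \<Sum>j\<in>UNIV. X $ (i, j) $ (k, j))"

definition implements :: "'a::finite op \<Rightarrow> (('s::finite \<times> 'a) op \<Rightarrow> ('s \<times> 'a) op) \<Rightarrow> ('x::finite \<Rightarrow> 'a op)
    \<Rightarrow> ('x \<Rightarrow> 's op \<Rightarrow> 's op) \<Rightarrow> bool" where
  "implements \<xi> \<E> Z I \<longleftrightarrow> (\<forall>x \<rho>. I x \<rho> = ptrace_A (tensor_op (mat 1) (Z x) ** \<E> (tensor_op \<rho> \<xi>)))"

definition measurement_scheme :: "'a::finite op \<Rightarrow> (('s::finite \<times> 'a) op \<Rightarrow> ('s \<times> 'a) op) \<Rightarrow> ('x::finite \<Rightarrow> 'a op) \<Rightarrow> bool" where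
  "measurement_scheme \<xi> \<E> Z \<longleftrightarrow> is_state \<xi> \<and> is_channel \<E> \<and> (\<forall>x. positive_op (Z x)) \<and> (\<Sum>x\<in>UNIV. Z x) = mat 1"

definition third_law_scheme :: "'a::finite op \<Rightarrow> (('s::finite \<times> 'a) op \<Rightarrow> ('s \<times> 'a) op) \<Rightarrow> ('x::finite \<Rightarrow> 'a op) \<Rightarrow> bool" where
  "third_law_scheme \<xi> \<E> Z \<longleftrightarrow> measurement_scheme \<xi> \<E> Z \<and> full_rank_state \<xi> \<and> third_law_channel \<E>"

definition unitary_op :: "'n::finite op \<Rightarrow> bool" where
  "unitary_op U \<longleftrightarrow> adj U ** U = mat 1 \<and> U ** adj U = mat 1"

end

theory Submission
  imports Defs
begin

text \<open>
  Extremality of \<open>I\<close> is exploited in two ways.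

  Rank bound: take linearly independent Kraus operators \<open>K\<^sub>1, \<dots>, K\<^sub>n\<close> of \<open>I\<^sub>x\<close>. All their rows lie
  in the row space of \<open>E\<^sub>x\<close>, since \<open>\<Sum> K\<^sub>i\<^sup>* K\<^sub>i = E\<^sub>x\<close>. Extremality makes the \<open>n\<^sup>2\<close> products
  \<open>K\<^sub>j\<^sup>* K\<^sub>i\<close> linearly independent, and they live in a space of dimension \<open>(rank E\<^sub>x)\<^sup>2\<close>, so
  \<open>n \<le> rank E\<^sub>x\<close>. By the third law \<open>I\<^sub>x\<close> maps some operator to a positive definite one, so the ranges
  of the \<open>K\<^sub>i\<close> span \<open>H\<^sub>S\<close> and \<open>dim H\<^sub>S \<le> n \<cdot> rank E\<^sub>x\<close>.

  Non-unitarity: as \<open>\<xi>\<close> has full rank, extremality forces every ancilla state to implement the same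
  instrument. If \<open>\<E> = U \<cdot> U\<^sup>*\<close>, then \<open>U\<^sup>*(B \<otimes> 1)U = \<Phi>(B) \<otimes> 1\<close> and \<open>U\<^sup>*(1 \<otimes> Z\<^sub>x)U = E\<^sub>x \<otimes> 1\<close>. These
  commute, and \<open>\<Phi>\<close> is linear and injective, hence onto; so every \<open>E\<^sub>x\<close> is scalar.
\<close>

subsection \<open>Linear systems and row spaces\<close>

text \<open>Gaussian elimination by induction on the equations: an unknown occurring in the new
  equation is eliminated from the others. General index sets are allowed because both dimension
  counts below index their equations by products of sets.\<close>

lemma homogeneous_system_nontrivial:
  fixes a :: "'i \<Rightarrow> 'j \<Rightarrow> 'f::field"
  assumes "finite J" "finite I" "card J < card I"
  shows "\<exists>c. (\<exists>i\<in>I. c i \<noteq> 0) \<and> (\<forall>j\<in>J. (\<Sum>i\<in>I. c i * a i j) = 0)"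
  using assms
proof (induction J arbitrary: I a rule: finite_induct)
  case empty
  then have "I \<noteq> {}" by auto
  then show ?case by (intro exI[of _ "\<lambda>_. 1"]) auto
next
  case (insert j J)
  show ?case
  proof (cases "\<forall>i\<in>I. a i j = 0")
    case True
    then show ?thesis using insert.IH[of I a] insert.prems insert.hyps by auto
  next
    case False
    then obtain i0 where i0: "i0 \<in> I" "a i0 j \<noteq> 0" by auto
    \<comment> \<open>Coefficients after the unknown \<open>i0\<close> has been solved for from
      equation \<open>j\<close>; \<open>c'\<close> below restores its value.\<close>
    define a' where "a' i l = a i l - a i j / a i0 j * a i0 l" for i l
    have "card J < card (I - {i0})" using insert i0 by simp
    then obtain c where c: "\<exists>i\<in>I - {i0}. c i \<noteq> 0" "\<And>l. l \<in> J \<Longrightarrow> (\<Sum>i\<in>I - {i0}. c i * a' i l) = 0"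
      using insert.IH[of "I - {i0}" a'] insert.prems by auto
    define s where "s = (\<Sum>i\<in>I - {i0}. c i * a i j)"
    define c' where "c' = c(i0 := - s / a i0 j)"
    have sum: "(\<Sum>i\<in>I. c' i * a i l) = - s / a i0 j * a i0 l + (\<Sum>i\<in>I - {i0}. c i * a i l)" for l
      by (subst sum.remove[OF insert.prems(1) i0(1)]) (auto simp: c'_def intro!: sum.cong)
    have "(\<Sum>i\<in>I. c' i * a i l) = 0" if "l \<in> J" for l
    proof -
      have "0 = (\<Sum>i\<in>I - {i0}. c i * a' i l)" using c(2)[OF that] by simp
      also have "\<dots> = (\<Sum>i\<in>I - {i0}. c i * a i l) - s / a i0 j * a i0 l"
        by (simp add: a'_def s_def algebra_simps sum_subtractf sum_distrib_left sum_divide_distrib)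
      finally show ?thesis by (simp add: sum)
    qed
    moreover have "(\<Sum>i\<in>I. c' i * a i j) = 0" using i0 by (simp add: sum s_def)
    moreover have "\<exists>i\<in>I. c' i \<noteq> 0" using c(1) by (auto simp: c'_def)
    ultimately show ?thesis by blast
  qed
qed

text \<open>A linear functional that kills the row space but not \<open>k\<close> is, in
  coordinates, the pairing with some vector \<open>v\<close>. The pairing carries no conjugation, to
  match \<open>A *v v\<close>.\<close>

lemma kernel_vector_off_row_space:
  fixes A :: "'f::field^'n^'m" and k :: "'f^'n"
  assumes "k \<notin> vec.span (rows A)"
  obtains v where "A *v v = 0" "(\<Sum>i\<in>UNIV. k $ i * v $ i) \<noteq> 0"
proof -
  obtain B where B: "B \<subseteq> rows A" "vec.independent B" "rows A \<subseteq> vec.span B"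
    using vec.basis_exists[of "rows A"] by metis
  have sp: "vec.span B = vec.span (rows A)"
    using B by (metis vec.span_mono vec.span_span subset_antisym)
  have "k \<notin> B" using assms sp vec.span_base by blast
  have ind: "vec.independent (insert k B)"
    using B(2) assms sp by (simp add: vec.independent_insert)
  \<comment> \<open>The extension result yields a vector-valued map; reading off the coordinate
    \<open>undefined\<close>, where \<open>t\<close> is 1, turns it into a functional.\<close>
  define t :: "'f^'n" where "t = axis undefined 1"
  obtain f :: "'f^'n \<Rightarrow> 'f^'n" where f: "Vector_Spaces.linear (*s) (*s) f"
      "\<forall>x\<in>insert k B. f x = (if x = k then t else 0)"
    using vec.linear_independent_extend[OF ind, of "\<lambda>x. if x = k then t else 0"] by blast
  interpret f: Vector_Spaces.linear "(*s)" "(*s)" f by (rule f(1))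
  have f0: "f x = 0" if "x \<in> vec.span B" for x
  proof -
    have "f b = 0" if "b \<in> B" for b using f(2) that \<open>k \<notin> B\<close> by auto
    then show ?thesis using f.eq_0_on_span that by blast
  qed
  have fk: "f k = t" using f(2) by simp
  define v where "v = (\<chi> i. f (axis i 1) $ undefined)"
  have fv: "f x $ undefined = (\<Sum>i\<in>UNIV. x $ i * v $ i)" for x
  proof -
    have "x = (\<Sum>i\<in>UNIV. x $ i *s axis i 1)" by (simp add: basis_expansion)
    then have "f x = (\<Sum>i\<in>UNIV. x $ i *s f (axis i 1))"
      by (metis (no_types, lifting) f.sum f.scale sum.cong)
    then show ?thesis by (simp add: v_def)
  qed
  have "A *v v = 0"
  proof (rule vec_eq_iff[THEN iffD2], rule allI)
    fix i
    have "row i A \<in> vec.span B" using B(3) by (auto simp: rows_def)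
    then have "f (row i A) = 0" by (rule f0)
    then show "(A *v v) $ i = 0 $ i" using fv[of "row i A"]
      by (simp add: matrix_vector_mult_def row_def)
  qed
  moreover have "(\<Sum>i\<in>UNIV. k $ i * v $ i) \<noteq> 0"
    using fv[of k] fk by (simp add: t_def)
  ultimately show ?thesis by (rule that)
qed

subsection \<open>Quadratic forms and positive operators\<close>

definition cip :: "complex^'n \<Rightarrow> complex^'n \<Rightarrow> complex" where
  "cip x y = (\<Sum>i\<in>UNIV. cnj (x $ i) * y $ i)"

lemma qform_cip: "qform A v = cip v (A *v v)"
  by (simp add: qform_def cip_def)

lemma cip_add_left: "cip (x + y) z = cip x z + cip y z"
  and cip_add_right: "cip x (y + z) = cip x y + cip x z"
  by (simp_all add: cip_def algebra_simps sum.distrib)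

lemma cip_axis_left: "cip (axis i a) y = cnj a * y $ i"
proof -
  have "cip (axis i a) y = (\<Sum>k\<in>UNIV. if k = i then cnj a * y $ i else 0)"
    unfolding cip_def axis_def by (rule sum.cong) auto
  then show ?thesis by simp
qed

lemma mult_axis: "(A *v axis i a) $ k = A $ k $ i * (a::complex)"
proof -
  have "(A *v axis i a) $ k = (\<Sum>j\<in>UNIV. if j = i then A $ k $ i * a else 0)"
    unfolding matrix_vector_mult_def axis_def vec_lambda_beta by (rule sum.cong) auto
  then show ?thesis by simp
qed

lemma cip_self: "cip x x = complex_of_real ((norm x)\<^sup>2)"
proof -
  have "cip x x = complex_of_real (\<Sum>i\<in>UNIV. (norm (x $ i))\<^sup>2)"
    unfolding cip_def of_real_sum complex_norm_square by (simp add: mult.commute)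
  also have "(\<Sum>i\<in>UNIV. (norm (x $ i))\<^sup>2) = (norm x)\<^sup>2"
    by (simp add: norm_vec_def L2_set_def sum_nonneg)
  finally show ?thesis .
qed

lemma cip_adj: "cip x (A *v y) = cip (adj A *v x) y"
  unfolding cip_def matrix_vector_mult_def adj_def
  by (simp add: sum_distrib_left sum_distrib_right, subst sum.swap)
    (simp add: mult_ac)

lemma adj_entry: "adj A $ i $ j = cnj (A $ j $ i)"
  by (simp add: adj_def)

lemma qform_conj: "qform (K ** X ** adj K) v = qform X (adj K *v v)"
  by (simp add: qform_cip cip_adj flip: matrix_vector_mul_assoc)

lemma qform_add_axis:
  "qform A (x + axis i a) = qform A x + a * cip x (A *v axis i 1) + cnj a * (A *v x) $ i + cnj a * a * A $ i $ i"
proof -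
  have "cip x (A *v axis i a) = a * cip x (A *v axis i 1)"
    by (simp add: cip_def mult_axis sum_distrib_left mult_ac)
  then show ?thesis
    by (simp add: qform_cip matrix_vector_right_distrib cip_add_left cip_add_right cip_axis_left mult_axis algebra_simps)
qed

lemma qform_two_axes:
  "qform A (axis j b + axis i a) =
     cnj b * b * A $ j $ j + a * cnj b * A $ j $ i + cnj a * b * A $ i $ j + cnj a * a * A $ i $ i"
  by (subst qform_add_axis) (simp add: qform_cip cip_axis_left mult_axis algebra_simps)

lemma qform_axis: "qform A (axis i a) = cnj a * a * A $ i $ i"
  by (simp add: qform_cip cip_axis_left mult_axis algebra_simps)

lemma positive_op_qform:
  assumes "positive_op A"
  shows "qform A v = complex_of_real (Re (qform A v))" "Re (qform A v) \<ge> 0"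
  using assms by (auto simp: positive_op_def complex_eq_iff)

lemma positive_op_diag:
  assumes "positive_op A"
  shows "A $ i $ i = complex_of_real (Re (A $ i $ i))" "Re (A $ i $ i) \<ge> 0"
  using positive_op_qform[OF assms, of "axis i 1"] by (simp_all add: qform_axis)

lemma positive_op_hermitian:
  assumes "positive_op A"
  shows "A $ i $ j = cnj (A $ j $ i)"
proof -
  have d: "Im (A $ k $ k) = 0" for k
    using positive_op_diag[OF assms, of k] by (metis Im_complex_of_real)
  \<comment> \<open>The first test vector makes the imaginary parts of the two entries opposite, the
    second makes their real parts equal.\<close>
  have "Im (qform A (axis j 1 + axis i 1)) = 0" "Im (qform A (axis j 1 + axis i \<i>)) = 0"
    using assms by (auto simp: positive_op_def)
  then show ?thesis by (simp add: qform_two_axes d complex_eq_iff)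
qed

text \<open>A nonzero entry in the row of a zero diagonal entry would let the form decrease linearly
  along axis \<open>i\<close>, with no quadratic term to stop it.\<close>

lemma positive_op_zero_diag:
  assumes "positive_op A" "A $ i $ i = 0"
  shows "A $ i $ j = 0"
proof (rule ccontr)
  assume "A $ i $ j \<noteq> 0"
  define q where "q = (cmod (A $ i $ j))\<^sup>2"
  \<comment> \<open>Chosen so that the form takes the value -1 at the test vector below.\<close>
  define t where "t = (Re (A $ j $ j) + 1) / (2 * q)"
  have q: "q > 0" using \<open>A $ i $ j \<noteq> 0\<close> by (simp add: q_def)
  have sq: "A $ i $ j * cnj (A $ i $ j) = complex_of_real q"
    by (simp only: q_def complex_norm_square)
  have "qform A (axis j 1 + axis i (- complex_of_real t * A $ i $ j))
      = A $ j $ j - 2 * complex_of_real t * (A $ i $ j * cnj (A $ i $ j))"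
    by (simp add: qform_two_axes assms(2) positive_op_hermitian[OF assms(1), of j i] algebra_simps)
  then have "Re (A $ j $ j) - 2 * t * q \<ge> 0"
    using positive_op_qform(2)[OF assms(1), of "axis j 1 + axis i (- complex_of_real t * A $ i $ j)"]
    unfolding sq by simp
  moreover have "2 * t * q = Re (A $ j $ j) + 1" using q by (simp add: t_def)
  ultimately show False by simp
qed

text \<open>In place of polarisation: such an \<open>A\<close> is positive with zero diagonal, and
  each zero diagonal entry kills its row.\<close>

lemma qform_all_zero:
  assumes "\<And>v. qform A v = 0"
  shows "A = 0"
proof -
  have "positive_op A" using assms by (simp add: positive_op_def)
  moreover have "A $ i $ i = 0" for i using assms[of "axis i 1"] by (simp add: qform_axis)
  ultimately show ?thesis by (simp add: vec_eq_iff positive_op_zero_diag)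
qed

text \<open>Schur complements give a Cholesky-type decomposition; indexing the vectors by their
  pivots makes them linearly independent.\<close>
lemma positive_op_decomposition:
  fixes A :: "'n::finite op"
  assumes "positive_op A"
  shows "\<exists>S w. (\<forall>i j. A $ i $ j = (\<Sum>k\<in>S. w k $ i * cnj (w k $ j))) \<and>
     (\<forall>c. (\<forall>i. (\<Sum>k\<in>S. c k * w k $ i) = 0) \<longrightarrow> (\<forall>k\<in>S. c k = 0)) \<and>
     S \<subseteq> {i::'n. A $ i $ i \<noteq> 0} \<and> (\<forall>k\<in>S. \<forall>i. A $ i $ i = 0 \<longrightarrow> w k $ i = 0)"
  using assms
proof (induction "card {i. A $ i $ i \<noteq> 0}" arbitrary: A rule: less_induct)
  case less
  note pos = \<open>positive_op A\<close>
  show ?case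
  proof (cases "\<forall>i. A $ i $ i = 0")
    case True
    then have "A = 0" using pos by (simp add: vec_eq_iff positive_op_zero_diag)
    then show ?thesis by (intro exI[of _ "{}"]) auto
  next
    case False
    then obtain p where p: "A $ p $ p \<noteq> 0" by auto
    define d where "d = Re (A $ p $ p)"
    have App: "A $ p $ p = complex_of_real d" and d: "d > 0"
      using positive_op_diag[OF pos, of p] p by (auto simp: d_def complex_eq_iff less_le)
    \<comment> \<open>Column \<open>p\<close>, scaled so that the rank-one operator of
      \<open>w0\<close> agrees with \<open>A\<close> in row and column \<open>p\<close>. Subtracting
      it leaves the Schur complement \<open>A'\<close>.\<close>
    define w0 where "w0 = (\<chi> i. A $ i $ p / complex_of_real (sqrt d))"
    have w0: "w0 $ i * cnj (w0 $ j) = A $ i $ p * A $ p $ j / complex_of_real d" for i j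
      using d positive_op_hermitian[OF pos, of p j]
      by (simp add: w0_def flip: of_real_mult)
    define A' :: "'n op" where "A' = (\<chi> i j. A $ i $ j - w0 $ i * cnj (w0 $ j))"
    have A'v: "(A' *v v) $ i = (A *v v) $ i - A $ i $ p * (A *v v) $ p / complex_of_real d" for v i
      by (simp add: A'_def w0 matrix_vector_mult_def algebra_simps sum_subtractf sum_divide_distrib sum_distrib_left)
    have cipA: "cip v (A *v axis p 1) = cnj ((A *v v) $ p)" for v
      unfolding cip_def mult_axis positive_op_hermitian[OF pos, of _ p]
      by (simp add: matrix_vector_mult_def mult_ac)
    \<comment> \<open>The shift along the pivot axis makes coordinate \<open>p\<close> of the image
      under \<open>A\<close> vanish. Every value of the form of \<open>A'\<close> is thus a value of
      the form of \<open>A\<close>, so positivity is inherited.\<close>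
    have q: "qform A' v = qform A (v + axis p (- (A *v v) $ p / complex_of_real d))" for v
    proof -
      have "qform A' v = qform A v - (\<Sum>i\<in>UNIV. cnj (v $ i) * A $ i $ p) * (A *v v) $ p / complex_of_real d"
        by (simp add: qform_def A'v algebra_simps sum_subtractf sum_divide_distrib sum_distrib_left)
      also have "(\<Sum>i\<in>UNIV. cnj (v $ i) * A $ i $ p) = cnj ((A *v v) $ p)"
        using cipA[of v] by (simp add: cip_def mult_axis)
      finally have "qform A' v = qform A v - cnj ((A *v v) $ p) * (A *v v) $ p / complex_of_real d" .
      then show ?thesis
        using d by (simp add: qform_add_axis cipA App)
    qed
    have pos': "positive_op A'" using pos by (simp add: positive_op_def q)
    have A'p: "A' $ i $ p = 0" for i using p App by (simp add: A'_def w0)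
    have A'0: "A' $ i $ i = 0" if "A $ i $ i = 0" for i
      using that positive_op_zero_diag[OF pos that] by (simp add: A'_def w0)
    have sub: "{i. A' $ i $ i \<noteq> 0} \<subset> {i. A $ i $ i \<noteq> 0}" using A'0 A'p p by blast
    then have "card {i. A' $ i $ i \<noteq> 0} < card {i. A $ i $ i \<noteq> 0}"
      by (simp add: psubset_card_mono)
    from less.hyps[OF this pos'] obtain S w where
      S: "\<And>i j. A' $ i $ j = (\<Sum>k\<in>S. w k $ i * cnj (w k $ j))"
      and ind: "\<And>c. (\<And>i. (\<Sum>k\<in>S. c k * w k $ i) = 0) \<Longrightarrow> (\<forall>k\<in>S. c k = 0)"
      and Ssub: "S \<subseteq> {i. A' $ i $ i \<noteq> 0}" and w0': "\<And>k i. k \<in> S \<Longrightarrow> A' $ i $ i = 0 \<Longrightarrow> w k $ i = 0"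
      by blast
    \<comment> \<open>The last two claims of the statement serve the induction: they keep the pivots
      distinct and make the vectors found for \<open>A'\<close> vanish at \<open>p\<close>.\<close>
    have pS: "p \<notin> S" using Ssub A'p by auto
    have cong: "(\<Sum>k\<in>S. f k ((w(p := w0)) k)) = (\<Sum>k\<in>S. f k (w k))" for f :: "_ \<Rightarrow> _ \<Rightarrow> complex"
      using pS by (intro sum.cong) auto
    have "\<forall>k\<in>insert p S. c k = 0" if c: "\<And>i. (\<Sum>k\<in>insert p S. c k * (w(p := w0)) k $ i) = 0" for c
    proof -
      have eq: "c p * w0 $ i + (\<Sum>k\<in>S. c k * w k $ i) = 0" for i
        using c[of i] pS cong[of "\<lambda>k x. c k * x $ i"] by simp
      \<comment> \<open>The system is triangular: at coordinate \<open>p\<close> only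
        \<open>w0\<close> contributes, so its coefficient vanishes first.\<close>
      have "(\<Sum>k\<in>S. c k * w k $ p) = 0" by (intro sum.neutral ballI) (simp add: w0' A'p)
      with eq[of p] p d have "c p = 0" by (simp add: w0_def)
      with eq ind[of c] show ?thesis by simp
    qed
    moreover have "A $ i $ j = (\<Sum>k\<in>insert p S. (w(p := w0)) k $ i * cnj ((w(p := w0)) k $ j))" for i j
    proof -
      have "A $ i $ j = w0 $ i * cnj (w0 $ j) + A' $ i $ j" by (simp add: A'_def)
      then show ?thesis using pS cong[of "\<lambda>k x. x $ i * cnj (x $ j)"] by (simp add: S)
    qed
    moreover have "insert p S \<subseteq> {i. A $ i $ i \<noteq> 0}" using Ssub sub p by auto
    moreover have "(w(p := w0)) k $ i = 0" if "k \<in> insert p S" "A $ i $ i = 0" for k i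
      using that w0' A'0 positive_op_zero_diag[OF pos that(2)] by (auto simp: w0_def)
    ultimately show ?thesis by blast
  qed
qed

lemma positive_op_gram:
  fixes A :: "'n::finite op"
  assumes "positive_op A"
  shows "\<exists>(S :: 'n set) w. \<forall>i j. A $ i $ j = (\<Sum>k\<in>S. w k $ i * cnj (w k $ j))"
  using positive_op_decomposition[OF assms] by (elim exE conjE) (intro exI)

subsection \<open>Kraus operators and completely positive maps\<close>

lemma sum_UNIV_pair: "(\<Sum>p\<in>UNIV. f p) = (\<Sum>i\<in>(UNIV::'s::finite set). \<Sum>j\<in>(UNIV::'a::finite set). f (i, j))"
  by (simp add: sum.cartesian_product split_def)

lemma op_smult_entry [simp]: "op_smult c A $ i $ j = c * A $ i $ j"
  by (simp add: op_smult_def)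

lemma adj_adj [simp]: "adj (adj A) = A"
  by (simp add: adj_def vec_eq_iff)

lemma block_qform_cip: "block_qform k X v = (\<Sum>a<k. \<Sum>b<k. cip (v a) (X a b *v v b))"
  by (simp add: block_qform_def cip_def)

lemma matrix_conj_entry:
  "(K ** X ** L) $ i $ j = (\<Sum>a\<in>UNIV. \<Sum>b\<in>UNIV. K $ i $ a * X $ a $ b * (L $ b $ j :: complex))"
  unfolding matrix_matrix_mult_def
  by (simp add: sum_distrib_right, subst sum.swap) simp

lemma matrix_conj_add: "(A :: complex^'n^'m) ** (X + Y) ** B = A ** X ** B + A ** Y ** B"
  by (simp add: vec_eq_iff matrix_conj_entry algebra_simps sum.distrib)

lemma matrix_conj_smult: "K ** op_smult c X ** L = op_smult c (K ** X ** L)"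
  by (simp add: vec_eq_iff matrix_conj_entry sum_distrib_left mult_ac)

text \<open>The adjoint of \<open>K\<close> moves onto the test vectors, so each block form of the
  image is a block form of the argument.\<close>

lemma completely_positive_conj:
  fixes K :: "complex^'n::finite^'m::finite"
  shows "completely_positive (\<lambda>X. K ** X ** adj K)"
  unfolding completely_positive_def clinear_map_def
proof (intro conjI allI impI)
  fix k and X :: "nat \<Rightarrow> nat \<Rightarrow> 'n op"
  assume pos: "block_positive k X"
  have "block_qform k (\<lambda>a b. K ** X a b ** adj K) v = block_qform k X (\<lambda>a. adj K *v v a)" for v
    by (simp add: block_qform_cip cip_adj flip: matrix_vector_mul_assoc)
  with pos show "block_positive k (\<lambda>a b. K ** X a b ** adj K)"
    by (simp add: block_positive_def)
qed (simp_all add: matrix_conj_add matrix_conj_smult)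

lemma completely_positive_zero: "completely_positive (\<lambda>X. 0)"
  by (simp add: completely_positive_def clinear_map_def block_positive_def block_qform_def vec_eq_iff)

lemma completely_positive_add:
  assumes "completely_positive \<Phi>" "completely_positive \<Psi>"
  shows "completely_positive (\<lambda>X. \<Phi> X + \<Psi> X)"
proof -
  have "block_qform k (\<lambda>a b. \<Phi> (X a b) + \<Psi> (X a b)) v =
      block_qform k (\<lambda>a b. \<Phi> (X a b)) v + block_qform k (\<lambda>a b. \<Psi> (X a b)) v" for k X v
    by (simp add: block_qform_cip matrix_vector_mult_add_rdistrib cip_add_right sum.distrib)
  then show ?thesis
    using assms
    by (auto simp: completely_positive_def clinear_map_def block_positive_def vec_eq_iff algebra_simps)
qed

lemma completely_positive_sum:
  assumes "finite S" "\<And>k. k \<in> S \<Longrightarrow> completely_positive (\<Phi> k)"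
  shows "completely_positive (\<lambda>X. \<Sum>k\<in>S. \<Phi> k X)"
  using assms
  by (induction S rule: finite_induct) (simp_all add: completely_positive_zero completely_positive_add)

lemma completely_positive_comp:
  assumes "completely_positive \<Phi>" "completely_positive \<Psi>"
  shows "completely_positive (\<lambda>X. \<Phi> (\<Psi> X))"
  using assms by (simp add: completely_positive_def clinear_map_def)

lemma completely_positive_kraus: "completely_positive (\<lambda>X. \<Sum>k\<in>(S :: 'k::finite set). K k ** X ** adj (K k))"
  by (intro completely_positive_sum completely_positive_conj) simp

text \<open>Splitting \<open>N\<close> into rank-one operators turns the double sum into an ordinary
  Kraus form with the mixed operators \<open>L l\<close>. This certifies the perturbed instruments
  in the extremality argument.\<close>

lemma completely_positive_kraus_form:
  fixes N :: "'k::finite op" and K :: "'k \<Rightarrow> complex^'n::finite^'m::finite"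
  assumes "positive_op N"
  shows "completely_positive (\<lambda>X. \<chi> i j. \<Sum>p\<in>UNIV. \<Sum>q\<in>UNIV. N $ p $ q * (K p ** X ** adj (K q)) $ i $ j)"
proof -
  obtain S :: "'k set" and g where N: "\<forall>p q. N $ p $ q = (\<Sum>l\<in>S. g l $ p * cnj (g l $ q))"
    using positive_op_gram[OF assms] by blast
  define L where "L l = (\<chi> i a. \<Sum>p\<in>UNIV. g l $ p * K p $ i $ a)" for l
  have "(\<Sum>l\<in>S. L l ** X ** adj (L l)) =
      (\<chi> i j. \<Sum>p\<in>UNIV. \<Sum>q\<in>UNIV. N $ p $ q * (K p ** X ** adj (K q)) $ i $ j)" for X
  proof -
    have "(L l ** X ** adj (L l)) $ i $ j =
       (\<Sum>p\<in>UNIV. \<Sum>q\<in>UNIV. g l $ p * cnj (g l $ q) * (K p ** X ** adj (K q)) $ i $ j)" for l i j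
    proof -
      have "(L l ** X ** adj (L l)) $ i $ j = (\<Sum>a\<in>UNIV. \<Sum>b\<in>UNIV. \<Sum>p\<in>UNIV. \<Sum>q\<in>UNIV.
          g l $ p * cnj (g l $ q) * (K p $ i $ a * X $ a $ b * adj (K q) $ b $ j))"
        by (simp add: matrix_conj_entry L_def adj_entry sum_distrib_left sum_distrib_right mult_ac)
      also have "\<dots> = (\<Sum>a\<in>UNIV. \<Sum>p\<in>UNIV. \<Sum>q\<in>UNIV. \<Sum>b\<in>UNIV.
          g l $ p * cnj (g l $ q) * (K p $ i $ a * X $ a $ b * adj (K q) $ b $ j))"
        by (intro sum.cong refl, subst sum.swap, intro sum.cong refl, rule sum.swap)
      also have "\<dots> = (\<Sum>p\<in>UNIV. \<Sum>q\<in>UNIV. \<Sum>a\<in>UNIV. \<Sum>b\<in>UNIV.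
          g l $ p * cnj (g l $ q) * (K p $ i $ a * X $ a $ b * adj (K q) $ b $ j))"
        by (subst sum.swap, intro sum.cong refl, rule sum.swap)
      finally show ?thesis by (simp add: matrix_conj_entry sum_distrib_left)
    qed
    note L = this
    have "(\<Sum>l\<in>S. L l ** X ** adj (L l)) $ i $ j =
       (\<Sum>p\<in>UNIV. \<Sum>q\<in>UNIV. N $ p $ q * (K p ** X ** adj (K q)) $ i $ j)" for i j
    proof -
      have "(\<Sum>l\<in>S. L l ** X ** adj (L l)) $ i $ j =
         (\<Sum>l\<in>S. \<Sum>p\<in>UNIV. \<Sum>q\<in>UNIV. g l $ p * cnj (g l $ q) * (K p ** X ** adj (K q)) $ i $ j)"
        by (simp add: L)
      also have "\<dots> = (\<Sum>p\<in>UNIV. \<Sum>l\<in>S. \<Sum>q\<in>UNIV. g l $ p * cnj (g l $ q) * (K p ** X ** adj (K q)) $ i $ j)"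
        by (rule sum.swap)
      also have "\<dots> = (\<Sum>p\<in>UNIV. \<Sum>q\<in>UNIV. \<Sum>l\<in>S. g l $ p * cnj (g l $ q) * (K p ** X ** adj (K q)) $ i $ j)"
        by (rule sum.cong[OF refl], rule sum.swap)
      finally show ?thesis by (simp add: N sum_distrib_right)
    qed
    then show ?thesis by (simp add: vec_eq_iff)
  qed
  then show ?thesis using completely_positive_kraus[of L S] by (simp add: fun_eq_iff)
qed

section \<open>Matrix units and Kraus operators from the Choi matrix\<close>

definition matrix_unit :: "'n \<Rightarrow> 'n \<Rightarrow> 'n::finite op" where
  "matrix_unit a b = (\<chi> i j. if i = a \<and> j = b then 1 else 0)"

lemma clinear_map_sum:
  assumes "clinear_map \<Phi>" "finite S"
  shows "\<Phi> (\<Sum>k\<in>S. X k) = (\<Sum>k\<in>S. \<Phi> (X k))"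
proof -
  have "op_smult 0 A = 0" for A :: "complex^'n^'m" by (simp add: vec_eq_iff)
  then have "\<Phi> 0 = 0" using assms(1) unfolding clinear_map_def
    by (metis op_smult_def mult_zero_left vec_lambda_unique zero_index)
  with assms(2,1) show ?thesis
    by (induction S rule: finite_induct) (auto simp: clinear_map_def)
qed

lemma matrix_unit_expansion: "X = (\<Sum>a\<in>UNIV. \<Sum>b\<in>UNIV. op_smult (X $ a $ b) (matrix_unit a b))"
proof -
  have "(\<Sum>a\<in>UNIV. \<Sum>b\<in>UNIV. X $ a $ b * matrix_unit a b $ i $ j) =
     (\<Sum>a\<in>UNIV. \<Sum>b\<in>UNIV. if b = j then (if a = i then X $ i $ j else 0) else 0)" for i j
    by (intro sum.cong refl) (auto simp: matrix_unit_def)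
  then show ?thesis by (simp add: vec_eq_iff)
qed

lemma clinear_map_expansion:
  assumes "clinear_map \<Phi>"
  shows "\<Phi> X $ i $ j = (\<Sum>a\<in>UNIV. \<Sum>b\<in>UNIV. X $ a $ b * \<Phi> (matrix_unit a b) $ i $ j)"
proof -
  have "\<Phi> X = (\<Sum>a\<in>UNIV. \<Sum>b\<in>UNIV. op_smult (X $ a $ b) (\<Phi> (matrix_unit a b)))"
    using assms
    by (subst matrix_unit_expansion) (simp add: clinear_map_sum clinear_map_def)
  then show ?thesis by simp
qed

text \<open>The Kraus operators come from the decomposition of the Choi matrix.\<close>
lemma kraus_decomposition:
  fixes \<Phi> :: "'n::finite op \<Rightarrow> 'm::finite op"
  assumes "completely_positive \<Phi>"
  obtains K :: "('n \<times> 'm) \<Rightarrow> complex^'n^'m" and S where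
    "\<And>X. \<Phi> X = (\<Sum>k\<in>S. K k ** X ** adj (K k))"
    "\<And>k. k \<notin> S \<Longrightarrow> K k = 0"
    "\<And>c. (\<And>i a. (\<Sum>k\<in>S. c k * K k $ i $ a) = 0) \<Longrightarrow> \<forall>k\<in>S. c k = 0"
proof -
  have lin: "clinear_map \<Phi>" using assms by (simp add: completely_positive_def)
  define d where "d = CARD('n)"
  \<comment> \<open>Blocks are indexed by naturals, basis vectors by \<open>'n\<close>;
    \<open>g\<close> translates between the two.\<close>
  obtain g :: "nat \<Rightarrow> 'n" where g: "bij_betw g {..<d} UNIV"
    unfolding d_def using ex_bij_betw_nat_finite[of "UNIV :: 'n set"] by (auto simp: atLeast0LessThan)
  \<comment> \<open>The Choi matrix, input index first. Its form will be the block form of the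
    images of all matrix units.\<close>
  define C :: "('n \<times> 'm) op" where "C = (\<chi> p q. \<Phi> (matrix_unit (fst p) (fst q)) $ snd p $ snd q)"
  have "positive_op C"
    unfolding positive_op_def
  proof
    fix v :: "complex^('n \<times> 'm)"
    define X where "X a b = matrix_unit (g a) (g b)" for a b
    have unit: "cip x (matrix_unit a b *v y) = cnj (x $ a) * y $ b" for x y :: "complex^'n" and a b
    proof -
      have "cip x (matrix_unit a b *v y) =
        (\<Sum>i\<in>UNIV. \<Sum>j\<in>UNIV. if j = b then (if i = a then cnj (x $ a) * y $ b else 0) else 0)"
        unfolding cip_def matrix_vector_mult_def matrix_unit_def vec_lambda_beta sum_distrib_left
        by (intro sum.cong refl) auto
      then show ?thesis by simp
    qed
    \<comment> \<open>The block operator of all matrix units is the rank-one operator of an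
      unnormalised maximally entangled vector, so its form is a squared modulus.\<close>
    have "block_qform d X x = (\<Sum>a<d. x a $ g a) * cnj (\<Sum>b<d. x b $ g b)" for x
      by (subst mult.commute) (simp add: block_qform_cip X_def unit sum_product)
    then have "block_qform d X x = complex_of_real ((cmod (\<Sum>a<d. x a $ g a))\<^sup>2)" for x
      by (simp only: complex_norm_square)
    then have "block_positive d X"
      by (simp add: block_positive_def)
    then have pos: "block_positive d (\<lambda>a b. \<Phi> (X a b))"
      using assms by (simp add: completely_positive_def)
    define x where "x a = (\<chi> i. v $ (g a, i))" for a
    define h where "h a b = (\<Sum>i\<in>UNIV. \<Sum>j\<in>UNIV. cnj (v $ (a, i)) * (\<Phi> (matrix_unit a b) $ i $ j * v $ (b, j)))"
      for a b
    have "block_qform d (\<lambda>a b. \<Phi> (X a b)) x = (\<Sum>a<d. \<Sum>b<d. h (g a) (g b))"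
      by (simp add: block_qform_cip cip_def matrix_vector_mult_def x_def X_def h_def sum_distrib_left)
    also have "\<dots> = (\<Sum>a\<in>UNIV. \<Sum>b<d. h a (g b))"
      by (rule sum.reindex_bij_betw[OF g])
    also have "\<dots> = (\<Sum>a\<in>UNIV. \<Sum>b\<in>UNIV. h a b)"
      by (intro sum.cong refl sum.reindex_bij_betw[OF g])
    also have "\<dots> = (\<Sum>a\<in>UNIV. \<Sum>i\<in>UNIV. \<Sum>b\<in>UNIV. \<Sum>j\<in>UNIV. cnj (v $ (a, i)) * (C $ (a, i) $ (b, j) * v $ (b, j)))"
      unfolding h_def by (intro sum.cong refl, subst sum.swap) (simp add: C_def)
    also have "\<dots> = qform C v"
      by (simp add: qform_def matrix_vector_mult_def sum_distrib_left sum_UNIV_pair)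
    finally have eq: "block_qform d (\<lambda>a b. \<Phi> (X a b)) x = qform C v" .
    from pos show "Im (qform C v) = 0 \<and> 0 \<le> Re (qform C v)"
      unfolding block_positive_def eq[symmetric] by blast
  qed
  from positive_op_decomposition[OF this] obtain S :: "('n \<times> 'm) set" and w where
    w: "\<forall>p q. C $ p $ q = (\<Sum>k\<in>S. w k $ p * cnj (w k $ q))" and
    ind: "\<forall>c. (\<forall>i. (\<Sum>k\<in>S. c k * w k $ i) = 0) \<longrightarrow> (\<forall>k\<in>S. c k = 0)"
    by (elim exE conjE) blast
  \<comment> \<open>The vectors of the decomposition reshaped to matrices, so their independence
    becomes that of the Kraus operators. The value 0 off \<open>S\<close> lets sums over
    \<open>S\<close> extend to the whole index type.\<close>
  define K where "K k = (if k \<in> S then \<chi> i a. w k $ (a, i) else 0)" for k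
  show ?thesis
  proof (rule that)
    fix X
    have "\<Phi> X $ i $ j = (\<Sum>k\<in>S. K k ** X ** adj (K k)) $ i $ j" for i j
    proof -
      have "\<Phi> X $ i $ j = (\<Sum>a\<in>UNIV. \<Sum>b\<in>UNIV. X $ a $ b * C $ (a, i) $ (b, j))"
        by (simp add: C_def clinear_map_expansion[OF lin, of X])
      also have "\<dots> = (\<Sum>a\<in>UNIV. \<Sum>k\<in>S. \<Sum>b\<in>UNIV. K k $ i $ a * X $ a $ b * adj (K k) $ b $ j)"
        by (intro sum.cong refl, subst sum.swap) (simp add: w K_def adj_entry sum_distrib_left mult_ac)
      also have "\<dots> = (\<Sum>k\<in>S. \<Sum>a\<in>UNIV. \<Sum>b\<in>UNIV. K k $ i $ a * X $ a $ b * adj (K k) $ b $ j)"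
        by (rule sum.swap)
      finally show ?thesis by (simp add: matrix_conj_entry)
    qed
    then show "\<Phi> X = (\<Sum>k\<in>S. K k ** X ** adj (K k))" by (simp add: vec_eq_iff)
  next
    fix k assume "k \<notin> S"
    then show "K k = 0" by (simp add: K_def)
  next
    fix c assume "\<And>i a. (\<Sum>k\<in>S. c k * K k $ i $ a) = 0"
    then show "\<forall>k\<in>S. c k = 0" by (intro ind[rule_format, THEN ballI]) (auto simp: K_def)
  qed
qed

section \<open>Tensoring with an ancilla and partial traces in Kraus form\<close>

definition tensor_vec :: "complex^'a \<Rightarrow> complex^'s^('s \<times> 'a)" where
  "tensor_vec s = (\<chi> p k. if fst p = k then s $ snd p else 0)"

lemma tensor_vec_mult: "(tensor_vec s *v v) $ (i, j) = v $ i * s $ j"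
proof -
  have "(tensor_vec s *v v) $ (i, j) = (\<Sum>k\<in>UNIV. if k = i then v $ i * s $ j else 0)"
    unfolding tensor_vec_def matrix_vector_mult_def vec_lambda_beta by (rule sum.cong) auto
  then show ?thesis by simp
qed

lemma tensor_vec_conj_entry: "(tensor_vec s ** X ** adj (tensor_vec t)) $ p $ q =
    X $ fst p $ fst q * (s $ snd p * cnj (t $ snd q))"
proof -
  have "(tensor_vec s ** X ** adj (tensor_vec t)) $ p $ q = (\<Sum>a\<in>UNIV. \<Sum>b\<in>UNIV.
      if b = fst q then (if a = fst p then X $ fst p $ fst q * (s $ snd p * cnj (t $ snd q)) else 0) else 0)"
    unfolding matrix_conj_entry adj_entry tensor_vec_def vec_lambda_beta by (intro sum.cong refl) auto
  then show ?thesis by simp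
qed

text \<open>\<open>tensor_vec s\<close> sends \<open>v\<close> to the product vector of
  \<open>v\<close> and \<open>s\<close>, so rank-one terms of \<open>\<sigma>\<close> give Kraus
  operators of the map that adjoins the ancilla.\<close>

lemma tensor_op_kraus:
  assumes "\<And>i j. \<sigma> $ i $ j = (\<Sum>m\<in>T. s m $ i * cnj (s m $ j))"
  shows "tensor_op X \<sigma> = (\<Sum>m\<in>T. tensor_vec (s m) ** X ** adj (tensor_vec (s m)))"
  by (simp add: vec_eq_iff tensor_vec_conj_entry tensor_op_def assms sum_distrib_left)

lemma tensor_mat_1_mult:
  "(tensor_op (mat 1) Z ** Y) $ (i, j) $ q = (\<Sum>l\<in>UNIV. Z $ j $ l * Y $ (i, l) $ q)"
proof -
  have "(tensor_op (mat 1) Z ** Y) $ (i, j) $ q =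
      (\<Sum>k\<in>UNIV. if k = i then (\<Sum>l\<in>UNIV. Z $ j $ l * Y $ (i, l) $ q) else 0)"
    unfolding matrix_matrix_mult_def tensor_op_def vec_lambda_beta sum_UNIV_pair mat_def
    by (intro sum.cong refl) auto
  then show ?thesis by simp
qed

text \<open>A rank-one term of \<open>Z\<close> compresses \<open>Y\<close> to the product vectors
  with second factor \<open>z m\<close>. Complete positivity here, and later strict positivity of
  the outcome operators, are read off from this form.\<close>

lemma ptrace_kraus:
  assumes "\<And>i j. Z $ i $ j = (\<Sum>m\<in>T. z m $ i * cnj (z m $ j))"
  shows "ptrace_A (tensor_op (mat 1) Z ** Y) = (\<Sum>m\<in>T. adj (tensor_vec (z m)) ** Y ** tensor_vec (z m))"
proof -
  have emb: "(adj (tensor_vec s) ** Y ** tensor_vec s) $ i $ k =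
     (\<Sum>j\<in>UNIV. \<Sum>l\<in>UNIV. s $ l * cnj (s $ j) * Y $ (i, j) $ (k, l))" for s i k
  proof -
    have "(adj (tensor_vec s) ** Y ** tensor_vec s) $ i $ k =
      (\<Sum>a\<in>UNIV. \<Sum>j\<in>UNIV. \<Sum>b\<in>UNIV. \<Sum>l\<in>UNIV.
         if b = k then (if a = i then s $ l * cnj (s $ j) * Y $ (i, j) $ (k, l) else 0) else 0)"
      unfolding matrix_conj_entry adj_entry tensor_vec_def vec_lambda_beta sum_UNIV_pair
      by (intro sum.cong refl) auto
    also have "\<dots> = (\<Sum>j\<in>UNIV. \<Sum>a\<in>UNIV. \<Sum>l\<in>UNIV. \<Sum>b\<in>UNIV.
         if b = k then (if a = i then s $ l * cnj (s $ j) * Y $ (i, j) $ (k, l) else 0) else 0)"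
      by (subst sum.swap, intro sum.cong refl, rule sum.swap)
    also have "\<dots> = (\<Sum>j\<in>UNIV. \<Sum>l\<in>UNIV. \<Sum>a\<in>UNIV. \<Sum>b\<in>UNIV.
         if b = k then (if a = i then s $ l * cnj (s $ j) * Y $ (i, j) $ (k, l) else 0) else 0)"
      by (intro sum.cong refl, rule sum.swap)
    finally show ?thesis by simp
  qed
  have "ptrace_A (tensor_op (mat 1) Z ** Y) $ i $ k = (\<Sum>m\<in>T. adj (tensor_vec (z m)) ** Y ** tensor_vec (z m)) $ i $ k" for i k
  proof -
    have "ptrace_A (tensor_op (mat 1) Z ** Y) $ i $ k = (\<Sum>j\<in>UNIV. \<Sum>l\<in>UNIV. Z $ j $ l * Y $ (i, l) $ (k, j))"
      by (simp add: ptrace_A_def tensor_mat_1_mult)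
    also have "\<dots> = (\<Sum>j\<in>UNIV. \<Sum>l\<in>UNIV. \<Sum>m\<in>T. z m $ l * cnj (z m $ j) * Y $ (i, j) $ (k, l))"
      by (subst sum.swap) (simp add: assms sum_distrib_right)
    also have "\<dots> = (\<Sum>j\<in>UNIV. \<Sum>m\<in>T. \<Sum>l\<in>UNIV. z m $ l * cnj (z m $ j) * Y $ (i, j) $ (k, l))"
      by (intro sum.cong refl, rule sum.swap)
    also have "\<dots> = (\<Sum>m\<in>T. \<Sum>j\<in>UNIV. \<Sum>l\<in>UNIV. z m $ l * cnj (z m $ j) * Y $ (i, j) $ (k, l))"
      by (rule sum.swap)
    finally show ?thesis by (simp add: emb)
  qed
  then show ?thesis by (simp add: vec_eq_iff)
qed

lemma completely_positive_tensor:
  fixes \<sigma> :: "'a::finite op"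
  assumes "positive_op \<sigma>"
  shows "completely_positive (\<lambda>X. tensor_op X \<sigma>)"
proof -
  obtain T :: "'a set" and s where s: "\<forall>i j. \<sigma> $ i $ j = (\<Sum>m\<in>T. s m $ i * cnj (s m $ j))"
    using positive_op_gram[OF assms] by blast
  show ?thesis unfolding tensor_op_kraus[of \<sigma>, OF s[rule_format]] by (rule completely_positive_kraus)
qed

lemma completely_positive_ptrace:
  fixes Z :: "'a::finite op"
  assumes "positive_op Z"
  shows "completely_positive (\<lambda>Y. ptrace_A (tensor_op (mat 1) Z ** Y))"
proof -
  obtain T :: "'a set" and z where z: "\<forall>i j. Z $ i $ j = (\<Sum>m\<in>T. z m $ i * cnj (z m $ j))"
    using positive_op_gram[OF assms] by blast
  show ?thesis unfolding ptrace_kraus[of Z, OF z[rule_format]]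
    using completely_positive_kraus[of "\<lambda>m. adj (tensor_vec (z m))" T] by simp
qed

lemma trace_ptrace: "trace (ptrace_A Y) = trace Y"
  by (simp add: trace_def ptrace_A_def sum_UNIV_pair)

lemma trace_tensor: "trace (tensor_op X \<sigma>) = trace X * trace \<sigma>"
  by (simp add: trace_def tensor_op_def sum_UNIV_pair sum_product)

lemma sum_ptrace:
  assumes "(\<Sum>x\<in>UNIV. Z x) = mat 1"
  shows "(\<Sum>x\<in>UNIV. ptrace_A (tensor_op (mat 1) (Z x) ** Y)) = ptrace_A Y"
proof -
  have Z: "(\<Sum>x\<in>UNIV. Z x $ j $ l) = (if j = l then 1 else 0)" for j l
    using assms by (simp add: vec_eq_iff mat_def)
  have "(\<Sum>x\<in>UNIV. \<Sum>j\<in>UNIV. \<Sum>l\<in>UNIV. Z x $ j $ l * Y $ (i, l) $ (k, j)) = (\<Sum>j\<in>UNIV. Y $ (i, j) $ (k, j))" for i k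
  proof -
    have "(\<Sum>x\<in>UNIV. \<Sum>j\<in>UNIV. \<Sum>l\<in>UNIV. Z x $ j $ l * Y $ (i, l) $ (k, j)) =
       (\<Sum>j\<in>UNIV. \<Sum>l\<in>UNIV. \<Sum>x\<in>UNIV. Z x $ j $ l * Y $ (i, l) $ (k, j))"
      by (subst sum.swap, intro sum.cong refl, rule sum.swap)
    also have "\<dots> = (\<Sum>j\<in>UNIV. \<Sum>l\<in>UNIV. if j = l then Y $ (i, l) $ (k, j) else 0)"
      by (intro sum.cong refl) (simp add: Z flip: sum_distrib_right)
    finally show ?thesis by simp
  qed
  then show ?thesis by (simp add: vec_eq_iff ptrace_A_def tensor_mat_1_mult)
qed

lemma instrument_of_scheme:
  assumes "measurement_scheme \<sigma> \<E> Z"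
  shows "is_instrument (\<lambda>x \<rho>. ptrace_A (tensor_op (mat 1) (Z x) ** \<E> (tensor_op \<rho> \<sigma>)))"
proof -
  have "positive_op \<sigma>" "trace \<sigma> = 1" "completely_positive \<E>" "\<And>Y. trace (\<E> Y) = trace Y"
    "\<And>x. positive_op (Z x)" "(\<Sum>x\<in>UNIV. Z x) = mat 1"
    using assms by (auto simp: measurement_scheme_def is_state_def is_channel_def)
  then show ?thesis
    by (auto simp: is_instrument_def sum_ptrace trace_ptrace trace_tensor
        intro!: completely_positive_comp[OF completely_positive_ptrace]
          completely_positive_comp[OF _ completely_positive_tensor])
qed

section \<open>Bounds on quadratic forms and perturbation of positive definite operators\<close>

lemma qform_add: "qform (A + B) v = qform A v + qform B v"
  by (simp add: qform_cip matrix_vector_mult_add_rdistrib cip_add_right)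

lemma qform_op_smult: "qform (op_smult c A) v = c * qform A v"
  by (simp add: qform_def matrix_vector_mult_def sum_distrib_left mult_ac)

lemma qform_scaleR: "qform A (r *\<^sub>R v) = complex_of_real (r\<^sup>2) * qform A v"
  unfolding qform_def matrix_vector_mult_def vec_lambda_beta vector_scaleR_component
  by (simp add: sum_distrib_left scaleR_conv_of_real power2_eq_square mult_ac)

lemma qform_mat_1: "qform (mat 1) v = complex_of_real ((norm v)\<^sup>2)"
  by (simp add: qform_cip cip_self)

lemma qform_upper_bound: "\<exists>C>0. \<forall>v. cmod (qform A v) \<le> C * (norm v)\<^sup>2"
proof -
  define C where "C = (\<Sum>i\<in>UNIV. \<Sum>j\<in>UNIV. cmod (A $ i $ j))"
  have C0: "C \<ge> 0" by (simp add: C_def sum_nonneg)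
  have *: "cmod (qform A v) \<le> C * (norm v)\<^sup>2" for v
  proof -
    have "cmod (qform A v) \<le> (\<Sum>i\<in>UNIV. cmod (\<Sum>j\<in>UNIV. cnj (v $ i) * (A $ i $ j * v $ j)))"
      unfolding qform_def matrix_vector_mult_def vec_lambda_beta sum_distrib_left by (rule norm_sum)
    also have "\<dots> \<le> (\<Sum>i\<in>UNIV. \<Sum>j\<in>UNIV. cmod (cnj (v $ i) * (A $ i $ j * v $ j)))"
      by (intro sum_mono norm_sum)
    also have "\<dots> \<le> (\<Sum>i\<in>UNIV. \<Sum>j\<in>UNIV. cmod (A $ i $ j) * (norm v)\<^sup>2)"
    proof (intro sum_mono)
      fix i j
      have "cmod (v $ i) * cmod (v $ j) \<le> norm v * norm v"
        by (intro mult_mono) (simp_all add: Finite_Cartesian_Product.norm_nth_le)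
      then have "cmod (A $ i $ j) * (cmod (v $ i) * cmod (v $ j)) \<le> cmod (A $ i $ j) * (norm v * norm v)"
        by (intro mult_left_mono) simp_all
      then show "cmod (cnj (v $ i) * (A $ i $ j * v $ j)) \<le> cmod (A $ i $ j) * (norm v)\<^sup>2"
        by (simp add: norm_mult power2_eq_square mult_ac)
    qed
    finally show ?thesis by (simp add: C_def sum_distrib_right)
  qed
  \<comment> \<open>Adding 1 keeps the constant strictly positive even for \<open>A = 0\<close>; it
    serves as a denominator later.\<close>
  have "cmod (qform A v) \<le> (C + 1) * (norm v)\<^sup>2" for v
    using *[of v] by (simp add: distrib_right add_increasing2)
  then show ?thesis using C0 by (intro exI[of _ "C + 1"]) auto
qed

text \<open>The form attains its minimum on the compact unit sphere, this minimum is positive, and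
  scaling extends the bound to all vectors.\<close>

lemma positive_definite_lower_bound:
  assumes "positive_definite A"
  shows "\<exists>c>0. \<forall>v. c * (norm v)\<^sup>2 \<le> Re (qform A v)"
proof -
  define f where "f v = Re (qform A v)" for v
  have "continuous_on (sphere 0 1) f"
    unfolding f_def qform_def matrix_vector_mult_def vec_lambda_beta by (intro continuous_intros)
  moreover have "axis undefined 1 \<in> sphere (0 :: complex^'a) 1" by (simp add: norm_axis_1)
  ultimately obtain u where u: "norm u = 1" "\<And>v. norm v = 1 \<Longrightarrow> f u \<le> f v"
    using continuous_attains_inf[of "sphere (0 :: complex^'a) 1" f] by auto
  have "u \<noteq> 0" using u(1) by auto
  then have "f u > 0" using assms by (simp add: f_def positive_definite_def)
  moreover have "f u * (norm v)\<^sup>2 \<le> f v" for v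
  proof (cases "v = 0")
    case True
    then show ?thesis by (simp add: f_def qform_def)
  next
    case False
    have "f u \<le> f ((1 / norm v) *\<^sub>R v)" using False by (intro u(2)) simp
    also have "\<dots> = f v / (norm v)\<^sup>2"
      unfolding f_def qform_scaleR by (simp add: power_divide)
    finally show ?thesis using False by (simp add: field_simps)
  qed
  ultimately show ?thesis unfolding f_def by blast
qed

text \<open>The lower bound \<open>c\<close> for \<open>A\<close> absorbs the upper bound
  \<open>C\<close> for \<open>B\<close> as long as \<open>t\<close> is at most \<open>c / C\<close>
  in modulus. Both signs of \<open>t\<close> matter: \<open>B\<close> may be subtracted as well as
  added.\<close>

lemma positive_op_perturb:
  assumes "positive_definite A" "\<And>v. Im (qform B v) = 0"
  shows "\<exists>e>0. \<forall>t. \<bar>t\<bar> \<le> e \<longrightarrow> positive_op (A + op_smult (complex_of_real t) B)"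
proof -
  obtain c where c: "c > 0" "\<And>v. c * (norm v)\<^sup>2 \<le> Re (qform A v)"
    using positive_definite_lower_bound[OF assms(1)] by blast
  obtain C where C: "C > 0" "\<And>v. cmod (qform B v) \<le> C * (norm v)\<^sup>2"
    using qform_upper_bound[of B] by blast
  have "positive_op (A + op_smult (complex_of_real t) B)" if t: "\<bar>t\<bar> \<le> c / C" for t
    unfolding positive_op_def
  proof
    fix v
    have "\<bar>t * Re (qform B v)\<bar> \<le> c / C * (C * (norm v)\<^sup>2)"
      unfolding abs_mult using t abs_Re_le_cmod[of "qform B v"] C c(1)
      by (intro mult_mono) (auto intro: order_trans)
    also have "\<dots> \<le> Re (qform A v)" using c(2)[of v] C(1) by simp
    finally have "0 \<le> Re (qform A v) + t * Re (qform B v)" by linarith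
    moreover have "Im (qform A v) = 0"
      using assms(1) by (cases "v = 0") (auto simp: positive_definite_def qform_def)
    ultimately show "Im (qform (A + op_smult (complex_of_real t) B) v) = 0 \<and>
        0 \<le> Re (qform (A + op_smult (complex_of_real t) B) v)"
      by (simp add: qform_add qform_op_smult assms(2))
  qed
  then show ?thesis using c(1) C(1) by (intro exI[of _ "c / C"]) simp
qed

lemma trace_add: "trace (A + B) = trace A + trace (B :: 'n::finite op)"
  and trace_op_smult: "trace (op_smult c A) = c * trace (A :: 'n::finite op)"
  by (simp_all add: trace_def sum.distrib sum_distrib_left)

subsection \<open>Extremal instruments implemented by unitary channels\<close>

text \<open>A full-rank \<open>\<xi>\<close> is a proper convex combination of any given state with another one.\<close>
lemma extremal_ancilla_independent:
  assumes "third_law_scheme \<xi> \<E> Z" "implements \<xi> \<E> Z I" "extremal_instrument I" "is_state \<sigma>"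
  shows "I x \<rho> = ptrace_A (tensor_op (mat 1) (Z x) ** \<E> (tensor_op \<rho> \<sigma>))"
proof -
  have scheme: "measurement_scheme \<xi> \<E> Z" and pd: "positive_definite \<xi>" and tr: "trace \<xi> = 1"
    using assms(1) by (auto simp: third_law_scheme_def full_rank_state_def is_state_def)
  have pos: "positive_op \<sigma>" and tr\<sigma>: "trace \<sigma> = 1" using assms(4) by (auto simp: is_state_def)
  obtain e where e: "e > 0" "\<And>t. \<bar>t\<bar> \<le> e \<Longrightarrow> positive_op (\<xi> + op_smult (complex_of_real t) \<sigma>)"
    using positive_op_perturb[OF pd, of \<sigma>] pos by (auto simp: positive_op_def)
  \<comment> \<open>The bound \<open>e\<close> keeps \<open>\<xi>\<close> minus \<open>t\<close>
    times \<open>\<sigma>\<close> positive; the bound 1/2 makes \<open>t\<close> a proper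
    weight.\<close>
  define t where "t = min e (1/2)"
  have t: "0 < t" "t < 1" "t \<le> e" using e(1) by (auto simp: t_def)
  \<comment> \<open>The complementary state, normalised so that \<open>\<xi>\<close> is the mixture
    of \<open>\<sigma>\<close> and \<open>\<sigma>'\<close> with weights \<open>t\<close> and
    \<open>1 - t\<close>.\<close>
  define \<sigma>' where "\<sigma>' = op_smult (complex_of_real (1 / (1 - t))) (\<xi> + op_smult (complex_of_real (- t)) \<sigma>)"
  have t1: "complex_of_real (1 - t) \<noteq> 0" using t by simp
  have pos': "positive_op (\<xi> + op_smult (complex_of_real (- t)) \<sigma>)" using t e(2)[of "- t"] by simp
  have "trace \<sigma>' = 1" using t t1 by (simp add: \<sigma>'_def trace_op_smult trace_add tr tr\<sigma> field_simps)
  moreover have "positive_op \<sigma>'"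
    using pos' t(2) unfolding \<sigma>'_def positive_op_def qform_op_smult[of "complex_of_real (1 / (1 - t))"]
    by simp
  ultimately have "is_state \<sigma>'" by (simp add: is_state_def)
  have inst: "is_instrument (\<lambda>x \<rho>. ptrace_A (tensor_op (mat 1) (Z x) ** \<E> (tensor_op \<rho> \<tau>)))"
    if "is_state \<tau>" for \<tau>
    using scheme that by (intro instrument_of_scheme) (simp add: measurement_scheme_def)
  have \<xi>: "tensor_op \<rho> \<xi> = op_smult (complex_of_real t) (tensor_op \<rho> \<sigma>)
      + op_smult (complex_of_real (1 - t)) (tensor_op \<rho> \<sigma>')" for \<rho> :: "'b op"
    using t1 by (simp add: vec_eq_iff tensor_op_def \<sigma>'_def field_simps)
  have linE: "clinear_map \<E>" and linP: "clinear_map (\<lambda>Y :: ('b \<times> 'a) op. ptrace_A (tensor_op (mat 1) (Z x) ** Y))" for x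
    using scheme completely_positive_ptrace[of "Z x"]
    by (auto simp: measurement_scheme_def is_channel_def completely_positive_def)
  have "I x \<rho> = op_smult (complex_of_real t) (ptrace_A (tensor_op (mat 1) (Z x) ** \<E> (tensor_op \<rho> \<sigma>)))
      + op_smult (complex_of_real (1 - t)) (ptrace_A (tensor_op (mat 1) (Z x) ** \<E> (tensor_op \<rho> \<sigma>')))" for x \<rho>
  proof -
    have "I x \<rho> = ptrace_A (tensor_op (mat 1) (Z x) ** \<E> (tensor_op \<rho> \<xi>))"
      using assms(2) by (simp add: implements_def)
    then show ?thesis unfolding \<xi>[of \<rho>] using linE linP[of x] by (simp add: clinear_map_def)
  qed
  then have "(\<lambda>x \<rho>. ptrace_A (tensor_op (mat 1) (Z x) ** \<E> (tensor_op \<rho> \<sigma>))) = I"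
    using assms(3) t inst[OF assms(4)] inst[OF \<open>is_state \<sigma>'\<close>]
    unfolding extremal_instrument_def by blast
  from fun_cong[OF fun_cong[OF this, of x], of \<rho>] show ?thesis by simp
qed

section \<open>Operators determined by their traces against states\<close>

definition proj :: "complex^'n \<Rightarrow> 'n op" where
  "proj v = (\<chi> i j. v $ i * cnj (v $ j))"

lemma trace_mult: "trace (A ** B) = (\<Sum>i\<in>UNIV. \<Sum>j\<in>UNIV. A $ i $ j * (B $ j $ i :: complex))"
  by (simp add: trace_def matrix_matrix_mult_def)

lemma trace_mult_proj: "trace (A ** proj v) = qform A v"
  by (simp add: trace_mult proj_def qform_def matrix_vector_mult_def sum_distrib_left mult_ac)

lemma is_state_proj:
  assumes "norm v = 1"
  shows "is_state (proj v)"
proof -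
  have "qform (proj v) u = cip u v * cnj (cip u v)" for u
  proof -
    have p: "(proj v *v u) $ i = v $ i * cnj (cip u v)" for i
      by (simp add: proj_def matrix_vector_mult_def cip_def sum_distrib_left mult_ac)
    show ?thesis
      by (simp only: qform_def p cip_def[of u v] mult.assoc[symmetric] sum_distrib_right[symmetric])
  qed
  then have "qform (proj v) u = complex_of_real ((cmod (cip u v))\<^sup>2)" for u
    by (simp only: complex_norm_square)
  moreover have "trace (proj v) = 1"
    using trace_mult_proj[of "mat 1" v] assms by (simp add: qform_mat_1)
  ultimately show ?thesis by (simp add: is_state_def positive_op_def)
qed

lemma qform_zero_on_unit_vectors:
  assumes "\<And>v. norm v = 1 \<Longrightarrow> qform A v = 0"
  shows "A = 0"
proof (rule qform_all_zero)
  fix v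
  show "qform A v = 0"
  proof (cases "v = 0")
    case False
    then have "qform A ((1 / norm v) *\<^sub>R v) = 0" by (intro assms) simp
    then show ?thesis using False by (simp add: qform_scaleR)
  qed (simp add: qform_def)
qed

text \<open>Pure states suffice: their traces are the values of the quadratic form at unit vectors,
  and over the complex numbers these determine the operator.\<close>

lemma op_eq_if_trace_states_eq:
  assumes "\<And>\<rho>. is_state \<rho> \<Longrightarrow> trace (A ** \<rho>) = trace (B ** \<rho>)"
  shows "A = B"
proof -
  have "qform A v = qform B v" if "norm v = 1" for v
    using assms[OF is_state_proj[OF that]] by (simp add: trace_mult_proj)
  then have "A + op_smult (- 1) B = 0"
    by (intro qform_zero_on_unit_vectors) (simp add: qform_add qform_op_smult)
  then show ?thesis by (simp add: vec_eq_iff)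
qed

text \<open>For fixed system indices the ancilla block \<open>g\<close> has the same trace against
  every state, as a scalar operator does, and so is scalar. The indices of the matrix unit are
  swapped because the trace pairs entry \<open>(b, a)\<close> with \<open>(a, b)\<close>.\<close>

lemma tensor_mat_1_if_trace_ancilla_independent:
  fixes G :: "('s::finite \<times> 'a::finite) op"
  assumes "\<And>X \<sigma>. is_state \<sigma> \<Longrightarrow> trace (G ** tensor_op X \<sigma>) = f X"
  shows "G = tensor_op (\<chi> b a. f (matrix_unit a b)) (mat 1)"
proof -
  have "G $ (b, j) $ (a, l) = (if j = l then f (matrix_unit a b) else 0)" for a b j l
  proof -
    define g where "g = (\<chi> j l. G $ (b, j) $ (a, l))"
    have tr: "trace (G ** tensor_op (matrix_unit a b) \<sigma>) = trace (g ** \<sigma>)" for \<sigma> :: "'a op"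
    proof -
      have "trace (G ** tensor_op (matrix_unit a b) \<sigma>) =
        (\<Sum>i\<in>UNIV. \<Sum>j\<in>UNIV. \<Sum>k\<in>UNIV. if k = a then if i = b then (\<Sum>l\<in>UNIV. g $ j $ l * \<sigma> $ l $ j) else 0 else 0)"
        unfolding trace_mult sum_UNIV_pair tensor_op_def matrix_unit_def vec_lambda_beta g_def
        by (intro sum.cong refl) auto
      also have "\<dots> = (\<Sum>j\<in>UNIV. \<Sum>i\<in>UNIV. if i = b then (\<Sum>l\<in>UNIV. g $ j $ l * \<sigma> $ l $ j) else 0)"
        by (subst sum.swap) simp
      finally show ?thesis by (simp add: trace_mult)
    qed
    have "g = op_smult (f (matrix_unit a b)) (mat 1)"
    proof (rule op_eq_if_trace_states_eq)
      fix \<rho> :: "'a op" assume "is_state \<rho>"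
      then show "trace (g ** \<rho>) = trace (op_smult (f (matrix_unit a b)) (mat 1) ** \<rho>)"
        using assms[of \<rho> "matrix_unit a b"] matrix_conj_smult[of "mat 1" "f (matrix_unit a b)" "mat 1" \<rho>]
        by (simp add: tr is_state_def trace_op_smult)
    qed
    then have "g $ j $ l = (if j = l then f (matrix_unit a b) else 0)" by (simp add: mat_def)
    then show ?thesis by (simp add: g_def)
  qed
  then show ?thesis by (simp add: vec_eq_iff tensor_op_def mat_def)
qed

lemma tensor_mult: "tensor_op A B ** tensor_op C D = tensor_op (A ** C) (B ** D)"
  by (simp add: vec_eq_iff matrix_matrix_mult_def tensor_op_def sum_UNIV_pair sum_product mult_ac)

lemma tensor_mat_1_cancel: "tensor_op A (mat 1 :: 'a::finite op) = tensor_op B (mat 1) \<longleftrightarrow> A = B"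
proof
  assume *: "tensor_op A (mat 1 :: 'a op) = tensor_op B (mat 1)"
  have "tensor_op A (mat 1 :: 'a op) $ (i, undefined) $ (j, undefined) = A $ i $ j" for A :: "'b op" and i j
    by (simp add: tensor_op_def mat_def)
  with * show "A = B" by (metis vec_eq_iff)
qed simp

text \<open>Comparing entries of the products with matrix units kills the off-diagonal entries and
  equates all diagonal ones.\<close>

lemma scalar_if_commutes:
  fixes A :: "'n::finite op"
  assumes "\<And>B. A ** B = B ** A"
  shows "A = op_smult (A $ k $ k) (mat 1)"
proof -
  have l: "(A ** matrix_unit a b) $ i $ j = (if j = b then A $ i $ a else 0)" for a b i j
  proof -
    have "(A ** matrix_unit a b) $ i $ j = (\<Sum>k\<in>UNIV. if k = a then if j = b then A $ i $ a else 0 else 0)"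
      unfolding matrix_matrix_mult_def matrix_unit_def vec_lambda_beta by (intro sum.cong refl) auto
    then show ?thesis by simp
  qed
  have r: "(matrix_unit a b ** A) $ i $ j = (if i = a then A $ b $ j else 0)" for a b i j
  proof -
    have "(matrix_unit a b ** A) $ i $ j = (\<Sum>k\<in>UNIV. if k = b then if i = a then A $ b $ j else 0 else 0)"
      unfolding matrix_matrix_mult_def matrix_unit_def vec_lambda_beta by (intro sum.cong refl) auto
    then show ?thesis by simp
  qed
  have e: "(if j = b then A $ i $ a else 0) = (if i = a then A $ b $ j else 0)" for a b i j
    using assms[of "matrix_unit a b"] l[of a b i j] r[of a b i j] by simp
  have entry: "A $ i $ j = (if i = j then A $ k $ k else 0)" for i j
    using e[where a = j and b = j and i = i and j = j] e[where a = k and b = j and i = k and j = j] by simp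
  have "op_smult (A $ k $ k) (mat 1) $ i $ j = (if i = j then A $ k $ k else 0)" for i j
    by (simp add: mat_def)
  then show ?thesis unfolding vec_eq_iff by (intro allI, subst entry) (rule sym)
qed

lemma trace_mult_ptrace: "trace (B ** ptrace_A Y) = trace (tensor_op B (mat 1) ** Y)"
proof -
  have "trace (tensor_op B (mat 1) ** Y) = (\<Sum>i\<in>UNIV. \<Sum>j\<in>UNIV. \<Sum>k\<in>UNIV. \<Sum>l\<in>UNIV.
      if l = j then B $ i $ k * Y $ (k, j) $ (i, j) else 0)"
    unfolding trace_mult sum_UNIV_pair tensor_op_def mat_def vec_lambda_beta
    by (intro sum.cong refl) auto
  also have "\<dots> = (\<Sum>i\<in>UNIV. \<Sum>k\<in>UNIV. \<Sum>j\<in>UNIV. B $ i $ k * Y $ (k, j) $ (i, j))"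
    by (subst sum.swap) simp
  finally show ?thesis by (simp add: trace_mult ptrace_A_def sum_distrib_left)
qed

text \<open>In the Heisenberg picture, independence of the ancilla state says that
  \<open>adj U ** G ** U\<close> acts trivially on the ancilla, both for observables
  \<open>G\<close> of the system and for the pointer \<open>Z x\<close>.\<close>

lemma extremal_not_unitary:
  fixes \<xi> :: "'a::finite op" and \<E> :: "('s::finite \<times> 'a) op \<Rightarrow> ('s \<times> 'a) op"
  assumes scheme: "third_law_scheme \<xi> \<E> Z" and "nontrivial_observable E" and inst: "is_E_instrument E I"
    and impl: "implements \<xi> \<E> Z I" and ext: "extremal_instrument I"
    and U: "unitary_op U" and \<E>: "\<And>X. \<E> X = U ** X ** adj U"
  shows False
proof -
  have UU: "adj U ** U = mat 1" "U ** adj U = mat 1" using U by (auto simp: unitary_op_def)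
  have Z1: "(\<Sum>x\<in>UNIV. Z x) = mat 1"
    using scheme by (simp add: third_law_scheme_def measurement_scheme_def)
  have cyc: "trace (adj U ** A ** U ** X) = trace (A ** \<E> X)" for A X
    using trace_mul_sym[of "adj U" "A ** U ** X"] by (simp add: \<E> matrix_mul_assoc)
  note I_eq = extremal_ancilla_independent[OF scheme impl ext]
  \<comment> \<open>The trace dual of the total channel, the sum of all \<open>I x\<close>.\<close>
  define \<Phi> where "\<Phi> B = (\<chi> b a. trace (B ** (\<Sum>x\<in>UNIV. I x (matrix_unit a b))))" for B
  have \<Phi>: "adj U ** tensor_op B (mat 1) ** U = tensor_op (\<Phi> B) (mat 1)" for B
    unfolding \<Phi>_def
    by (rule tensor_mat_1_if_trace_ancilla_independent[where f = "\<lambda>X. trace (B ** (\<Sum>x\<in>UNIV. I x X))"])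
      (simp add: cyc I_eq sum_ptrace[OF Z1] trace_mult_ptrace)
  \<comment> \<open>The effect measured by \<open>I x\<close>, written out entrywise; it is
    identified with \<open>E x\<close> below.\<close>
  define e where "e x = (\<chi> b a. trace (I x (matrix_unit a b)))" for x
  have e: "adj U ** tensor_op (mat 1) (Z x) ** U = tensor_op (e x) (mat 1)" for x
    unfolding e_def
    by (rule tensor_mat_1_if_trace_ancilla_independent[where f = "\<lambda>X. trace (I x X)"])
      (simp add: cyc I_eq trace_ptrace)
  have eE: "E x = e x" for x
  proof (rule op_eq_if_trace_states_eq)
    fix \<rho> :: "'s op" assume \<rho>: "is_state \<rho>"
    have \<xi>: "is_state \<xi>" using scheme by (simp add: third_law_scheme_def measurement_scheme_def)
    have "trace (I x \<rho>) = trace (adj U ** tensor_op (mat 1) (Z x) ** U ** tensor_op \<rho> \<xi>)"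
      by (simp add: cyc I_eq[OF \<xi>] trace_ptrace)
    also have "\<dots> = trace (e x ** \<rho>)"
      using \<xi> by (simp add: e tensor_mult trace_tensor is_state_def)
    finally show "trace (E x ** \<rho>) = trace (e x ** \<rho>)"
      using inst \<rho> by (simp add: is_E_instrument_def)
  qed
  \<comment> \<open>Operators on different tensor factors commute, and conjugation by the unitary
    \<open>U\<close> is multiplicative.\<close>
  have comm: "e x ** \<Phi> B = \<Phi> B ** e x" for x B
  proof -
    have conj_mult: "(adj U ** A ** U) ** (adj U ** A' ** U) = adj U ** (A ** A') ** U" for A A'
    proof -
      have "(adj U ** A ** U) ** (adj U ** A' ** U) = adj U ** A ** (U ** adj U) ** A' ** U"
        by (simp only: matrix_mul_assoc)
      then show ?thesis by (simp add: UU matrix_mul_assoc)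
    qed
    have "tensor_op (e x ** \<Phi> B) (mat 1 :: 'a op) = tensor_op (\<Phi> B ** e x) (mat 1)"
      using conj_mult[of "tensor_op (mat 1) (Z x)" "tensor_op B (mat 1)"]
        conj_mult[of "tensor_op B (mat 1)" "tensor_op (mat 1) (Z x)"]
      by (simp add: e \<Phi> tensor_mult)
    then show ?thesis by (simp add: tensor_mat_1_cancel)
  qed
  have "linear \<Phi>"
    by (rule linearI)
      (simp_all add: \<Phi>_def vec_eq_iff trace_mult algebra_simps sum.distrib scaleR_sum_right)
  moreover have "inj \<Phi>"
  proof (rule injI)
    fix A B assume "\<Phi> A = \<Phi> B"
    then have "U ** (adj U ** tensor_op A (mat 1) ** U) ** adj U = U ** (adj U ** tensor_op B (mat 1) ** U) ** adj U"
      by (simp add: \<Phi>)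
    moreover have "U ** (adj U ** Y ** U) ** adj U = Y" for Y
    proof -
      have "U ** (adj U ** Y ** U) ** adj U = (U ** adj U) ** Y ** (U ** adj U)"
        by (simp only: matrix_mul_assoc)
      then show ?thesis by (simp add: UU)
    qed
    ultimately show "A = B" by (simp add: tensor_mat_1_cancel)
  qed
  \<comment> \<open>Real dimensions are finite and equal, so injectivity gives surjectivity;
    \<open>e x\<close> then commutes with every operator.\<close>
  ultimately have "surj \<Phi>" by (intro linear_injective_imp_surjective) simp_all
  then have "e x ** B = B ** e x" for x B using comm by (metis surjD)
  then have "E x = op_smult (e x $ undefined $ undefined) (mat 1)" for x
    unfolding eE by (rule scalar_if_commutes)
  then show False using \<open>nontrivial_observable E\<close> by (auto simp: nontrivial_observable_def)
qed

subsection \<open>The rank bound\<close>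

lemma qform_sum: "finite T \<Longrightarrow> qform (\<Sum>m\<in>T. A m) v = (\<Sum>m\<in>T. qform (A m) v)"
  by (induction T rule: finite_induct) (simp_all add: qform_add, simp add: qform_def)

lemma qform_hermitian_real:
  assumes "adj M = M"
  shows "Im (qform M v) = 0"
proof -
  have "qform M v = cip (M *v v) v" using cip_adj[of v M v] by (simp add: qform_cip assms)
  also have "\<dots> = cnj (qform M v)" by (simp add: qform_cip cip_def mult.commute)
  finally show ?thesis by (metis complex_cnj_cancel_iff Reals_cnj_iff complex_is_Real_iff)
qed

lemma matrix_unit_conj_entry: "(K ** matrix_unit a b ** L) $ i $ j = K $ i $ a * L $ b $ j"
proof -
  have "(K ** matrix_unit a b ** L) $ i $ j =
      (\<Sum>a'\<in>UNIV. \<Sum>b'\<in>UNIV. if b' = b then if a' = a then K $ i $ a * L $ b $ j else 0 else 0)"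
    unfolding matrix_conj_entry matrix_unit_def vec_lambda_beta by (intro sum.cong refl) auto
  then show ?thesis by simp
qed

text \<open>If there were more Kraus operators than \<open>card B\<close>, then some nonzero Hermitian
  \<open>M\<close> would satisfy \<open>\<Sum> M p q \<cdot> (K q)\<^sup>* (K p) = 0\<close>, and \<open>I\<close> would be the midpoint of the two
  instruments perturbed by \<open>\<plusminus>e M\<close>.\<close>
lemma extremal_card_kraus_le:
  fixes I :: "'x::finite \<Rightarrow> 'n::finite op \<Rightarrow> 'n op" and K :: "'k::finite \<Rightarrow> complex^'n^'n"
  assumes inst: "is_instrument I" and ext: "extremal_instrument I"
    and K: "\<And>X. I x X = (\<Sum>k\<in>S. K k ** X ** adj (K k))"
    and K0: "\<And>k. k \<notin> S \<Longrightarrow> K k = 0"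
    and ind: "\<And>c. (\<And>i a. (\<Sum>k\<in>S. c k * K k $ i $ a) = 0) \<Longrightarrow> \<forall>k\<in>S. c k = 0"
    and B: "finite B" "\<And>k i a. K k $ i $ a = (\<Sum>b\<in>B. u k i b * b $ a)"
  shows "card S \<le> card B"
proof (rule ccontr)
  assume "\<not> card S \<le> card B"
  then have "card (B \<times> B) < card (S \<times> S)"
    by (simp add: card_cartesian_product mult_strict_mono)
  \<comment> \<open>Unknowns are the coefficients of the products \<open>adj (K q) ** K p\<close>.
    There is one equation per pair from \<open>B\<close>, since these products expand in the
    rank-one operators formed from such pairs.\<close>
  from homogeneous_system_nontrivial[OF _ _ this,
      of "\<lambda>pq bc. \<Sum>i\<in>UNIV. u (fst pq) i (fst bc) * cnj (u (snd pq) i (snd bc))"] B(1)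
  obtain m where m: "\<exists>pq\<in>S \<times> S. m pq \<noteq> 0"
    "\<And>b c. b \<in> B \<Longrightarrow> c \<in> B \<Longrightarrow>
       (\<Sum>pq\<in>S \<times> S. m pq * (\<Sum>i\<in>UNIV. u (fst pq) i b * cnj (u (snd pq) i c))) = 0"
    by auto
  \<comment> \<open>\<open>sol N\<close> states entrywise that the sum of \<open>N $ p $ q\<close>
    times \<open>adj (K q) ** K p\<close> vanishes.\<close>
  define sol where "sol N \<longleftrightarrow> (\<forall>a b. (\<Sum>p\<in>UNIV. \<Sum>q\<in>UNIV. N $ p $ q * (\<Sum>i\<in>UNIV. K p $ i $ a * cnj (K q $ i $ b))) = 0)"
    for N :: "'k op"
  define M0 where "M0 = (\<chi> p q. if p \<in> S \<and> q \<in> S then m (p, q) else 0)"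
  have KK: "(\<Sum>i\<in>UNIV. K p $ i $ a * cnj (K q $ i $ b)) =
     (\<Sum>bc\<in>B \<times> B. fst bc $ a * cnj (snd bc $ b) * (\<Sum>i\<in>UNIV. u p i (fst bc) * cnj (u q i (snd bc))))" for p q a b
  proof -
    have "(\<Sum>i\<in>UNIV. K p $ i $ a * cnj (K q $ i $ b)) =
      (\<Sum>i\<in>UNIV. \<Sum>bc\<in>B \<times> B. fst bc $ a * cnj (snd bc $ b) * (u p i (fst bc) * cnj (u q i (snd bc))))"
      by (simp add: B(2) sum_product sum.cartesian_product split_def mult_ac)
    also have "\<dots> = (\<Sum>bc\<in>B \<times> B. \<Sum>i\<in>UNIV. fst bc $ a * cnj (snd bc $ b) * (u p i (fst bc) * cnj (u q i (snd bc))))"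
      by (rule sum.swap)
    finally show ?thesis by (simp only: sum_distrib_left)
  qed
  have sol0: "sol M0"
    unfolding sol_def
  proof (intro allI)
    fix a b
    have "(\<Sum>p\<in>UNIV. \<Sum>q\<in>UNIV. M0 $ p $ q * (\<Sum>i\<in>UNIV. K p $ i $ a * cnj (K q $ i $ b)))
      = (\<Sum>pq\<in>UNIV. M0 $ fst pq $ snd pq * (\<Sum>i\<in>UNIV. K (fst pq) $ i $ a * cnj (K (snd pq) $ i $ b)))"
      by (simp add: sum_UNIV_pair)
    also have "\<dots> = (\<Sum>pq\<in>S \<times> S. m pq * (\<Sum>i\<in>UNIV. K (fst pq) $ i $ a * cnj (K (snd pq) $ i $ b)))"
      by (rule sum.mono_neutral_cong_right) (auto simp: M0_def)
    also have "\<dots> = (\<Sum>pq\<in>S \<times> S. \<Sum>bc\<in>B \<times> B. m pq * (fst bc $ a * cnj (snd bc $ b) *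
        (\<Sum>i\<in>UNIV. u (fst pq) i (fst bc) * cnj (u (snd pq) i (snd bc)))))"
      by (simp only: KK sum_distrib_left[where r = "m _"])
    also have "\<dots> = (\<Sum>bc\<in>B \<times> B. \<Sum>pq\<in>S \<times> S. m pq * (fst bc $ a * cnj (snd bc $ b) *
        (\<Sum>i\<in>UNIV. u (fst pq) i (fst bc) * cnj (u (snd pq) i (snd bc)))))"
      by (rule sum.swap)
    also have "\<dots> = (\<Sum>bc\<in>B \<times> B. fst bc $ a * cnj (snd bc $ b) * (\<Sum>pq\<in>S \<times> S. m pq *
        (\<Sum>i\<in>UNIV. u (fst pq) i (fst bc) * cnj (u (snd pq) i (snd bc)))))"
      by (simp only: sum_distrib_left[where r = "_ * cnj _"] mult.left_commute)
    also have "\<dots> = 0" by (intro sum.neutral) (auto simp: m(2))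
    finally show "(\<Sum>p\<in>UNIV. \<Sum>q\<in>UNIV. M0 $ p $ q * (\<Sum>i\<in>UNIV. K p $ i $ a * cnj (K q $ i $ b))) = 0" .
  qed
  have sol_adj: "sol (adj N)" if "sol N" for N
    unfolding sol_def
  proof (intro allI)
    fix a b
    have "(\<Sum>p\<in>UNIV. \<Sum>q\<in>UNIV. adj N $ p $ q * (\<Sum>i\<in>UNIV. K p $ i $ a * cnj (K q $ i $ b))) =
      (\<Sum>q\<in>UNIV. \<Sum>p\<in>UNIV. adj N $ p $ q * (\<Sum>i\<in>UNIV. K p $ i $ a * cnj (K q $ i $ b)))"
      by (rule sum.swap)
    also have "\<dots> = cnj (\<Sum>p\<in>UNIV. \<Sum>q\<in>UNIV. N $ p $ q * (\<Sum>i\<in>UNIV. K p $ i $ b * cnj (K q $ i $ a)))"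
      by (simp add: adj_entry mult_ac)
    also have "\<dots> = 0"
      using that[unfolded sol_def, rule_format, of b a] by (simp only: complex_cnj_zero)
    finally show "(\<Sum>p\<in>UNIV. \<Sum>q\<in>UNIV. adj N $ p $ q * (\<Sum>i\<in>UNIV. K p $ i $ a * cnj (K q $ i $ b))) = 0" .
  qed
  have sol_comb: "sol (op_smult c N + op_smult d N')" if "sol N" "sol N'" for c d N N'
  proof -
    have "(\<Sum>p\<in>UNIV. \<Sum>q\<in>UNIV. (op_smult c N + op_smult d N') $ p $ q * h p q) =
       c * (\<Sum>p\<in>UNIV. \<Sum>q\<in>UNIV. N $ p $ q * h p q) + d * (\<Sum>p\<in>UNIV. \<Sum>q\<in>UNIV. N' $ p $ q * h p q)" for h
      by (simp add: algebra_simps sum.distrib sum_distrib_left)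
    then show ?thesis using that by (simp add: sol_def)
  qed
  have "\<exists>M. sol M \<and> adj M = M \<and> (\<exists>p\<in>S. \<exists>q\<in>S. M $ p $ q \<noteq> 0)"
  proof -
    \<comment> \<open>Two Hermitian combinations of \<open>M0\<close> and its adjoint, both
      solutions. They recover \<open>M0\<close>, so at least one has a nonzero entry on
      \<open>S\<close>.\<close>
    define M1 where "M1 = op_smult 1 M0 + op_smult 1 (adj M0)"
    define M2 where "M2 = op_smult \<i> M0 + op_smult (- \<i>) (adj M0)"
    obtain p q where pq: "p \<in> S" "q \<in> S" "M0 $ p $ q \<noteq> 0" using m(1) by (auto simp: M0_def)
    have "2 * M0 $ p $ q = M1 $ p $ q - \<i> * M2 $ p $ q" by (simp add: M1_def M2_def algebra_simps)
    with pq(3) have "M1 $ p $ q \<noteq> 0 \<or> M2 $ p $ q \<noteq> 0" by auto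
    moreover have "sol M1" "sol M2" unfolding M1_def M2_def by (intro sol_comb sol0 sol_adj)+
    moreover have "adj M1 = M1" "adj M2 = M2" by (auto simp: M1_def M2_def vec_eq_iff adj_entry)
    ultimately show ?thesis using pq by blast
  qed
  then obtain M where M: "sol M" "adj M = M" and Mnz: "\<exists>p\<in>S. \<exists>q\<in>S. M $ p $ q \<noteq> 0" by blast
  have "positive_definite (mat 1 :: 'k op)" by (simp add: positive_definite_def qform_mat_1 del: of_real_power)
  from positive_op_perturb[OF this, of M] qform_hermitian_real[OF M(2)]
  obtain e where e: "e > 0" "\<And>t. \<bar>t\<bar> \<le> e \<Longrightarrow> positive_op (mat 1 + op_smult (complex_of_real t) M)" by blast
  \<comment> \<open>The direction of perturbation at outcome \<open>x\<close>. By cyclicity its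
    trace pairs \<open>X\<close> with the sum that \<open>sol M\<close> annihilates, so total trace
    is kept.\<close>
  define \<Delta> where "\<Delta> X = (\<chi> i j. \<Sum>p\<in>UNIV. \<Sum>q\<in>UNIV. M $ p $ q * (K p ** X ** adj (K q)) $ i $ j)" for X
  define J where "J t y X = I y X + (if y = x then op_smult (complex_of_real t) (\<Delta> X) else 0)" for t y X
  have tr\<Delta>: "trace (\<Delta> X) = 0" for X
  proof -
    have "trace (\<Delta> X) = (\<Sum>pq\<in>UNIV. M $ fst pq $ snd pq * trace (K (fst pq) ** X ** adj (K (snd pq))))"
    proof -
      have "trace (\<Delta> X) = (\<Sum>i\<in>UNIV. \<Sum>pq\<in>UNIV. M $ fst pq $ snd pq * (K (fst pq) ** X ** adj (K (snd pq))) $ i $ i)"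
        by (simp add: trace_def \<Delta>_def sum_UNIV_pair)
      also have "\<dots> = (\<Sum>pq\<in>UNIV. \<Sum>i\<in>UNIV. M $ fst pq $ snd pq * (K (fst pq) ** X ** adj (K (snd pq))) $ i $ i)"
        by (rule sum.swap)
      finally show ?thesis by (simp only: trace_def sum_distrib_left)
    qed
    also have "\<dots> = (\<Sum>pq\<in>UNIV. \<Sum>ba\<in>UNIV. M $ fst pq $ snd pq * (X $ snd ba $ fst ba *
        (\<Sum>i\<in>UNIV. K (fst pq) $ i $ snd ba * cnj (K (snd pq) $ i $ fst ba))))"
    proof (rule sum.cong[OF refl])
      fix pq :: "'k \<times> 'k"
      have "trace (K (fst pq) ** X ** adj (K (snd pq))) = trace (adj (K (snd pq)) ** K (fst pq) ** X)"
        using trace_mul_sym[of "K (fst pq) ** X" "adj (K (snd pq))"] by (simp add: matrix_mul_assoc)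
      also have "\<dots> = (\<Sum>b\<in>UNIV. \<Sum>a\<in>UNIV. X $ a $ b * (\<Sum>i\<in>UNIV. K (fst pq) $ i $ a * cnj (K (snd pq) $ i $ b)))"
        by (subst trace_mult) (simp add: matrix_matrix_mult_def adj_entry sum_distrib_left sum_distrib_right mult_ac)
      finally show "M $ fst pq $ snd pq * trace (K (fst pq) ** X ** adj (K (snd pq))) =
         (\<Sum>ba\<in>UNIV. M $ fst pq $ snd pq * (X $ snd ba $ fst ba *
           (\<Sum>i\<in>UNIV. K (fst pq) $ i $ snd ba * cnj (K (snd pq) $ i $ fst ba))))"
        by (simp only: sum_distrib_left sum_UNIV_pair fst_conv snd_conv)
    qed
    also have "\<dots> = (\<Sum>ba\<in>UNIV. \<Sum>pq\<in>UNIV. M $ fst pq $ snd pq * (X $ snd ba $ fst ba *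
        (\<Sum>i\<in>UNIV. K (fst pq) $ i $ snd ba * cnj (K (snd pq) $ i $ fst ba))))"
      by (rule sum.swap)
    also have "\<dots> = (\<Sum>ba\<in>UNIV. X $ snd ba $ fst ba * (\<Sum>pq\<in>UNIV. M $ fst pq $ snd pq *
        (\<Sum>i\<in>UNIV. K (fst pq) $ i $ snd ba * cnj (K (snd pq) $ i $ fst ba))))"
      by (simp only: sum_distrib_left[where r = "X $ _ $ _"] mult.left_commute)
    also have "\<dots> = 0"
    proof (intro sum.neutral ballI)
      fix ba :: "'n \<times> 'n"
      show "X $ snd ba $ fst ba * (\<Sum>pq\<in>UNIV. M $ fst pq $ snd pq *
        (\<Sum>i\<in>UNIV. K (fst pq) $ i $ snd ba * cnj (K (snd pq) $ i $ fst ba))) = 0"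
        using M(1) by (simp add: sol_def sum_UNIV_pair)
    qed
    finally show ?thesis .
  qed
  have J: "is_instrument (J t)" if t: "\<bar>t\<bar> \<le> e" for t
  proof -
    \<comment> \<open>\<open>I x\<close> is the Kraus form with coefficient matrix
      \<open>mat 1\<close>, so \<open>J t x\<close> has \<open>mat 1\<close> plus \<open>t\<close>
      times \<open>M\<close>, which is positive for small \<open>t\<close>.\<close>
    have "J t x = (\<lambda>X. \<chi> i j. \<Sum>p\<in>UNIV. \<Sum>q\<in>UNIV.
        (mat 1 + op_smult (complex_of_real t) M) $ p $ q * (K p ** X ** adj (K q)) $ i $ j)"
    proof
      fix X
      have "I x X = (\<Sum>k\<in>UNIV. K k ** X ** adj (K k))"
        unfolding K by (rule sum.mono_neutral_left) (auto simp: K0 vec_eq_iff matrix_conj_entry)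
      moreover have "(\<Sum>p\<in>UNIV. \<Sum>q\<in>UNIV. (mat 1 :: 'k op) $ p $ q * (K p ** X ** adj (K q)) $ i $ j) =
          (\<Sum>p\<in>UNIV. (K p ** X ** adj (K p)) $ i $ j)" for i j
      proof (rule sum.cong[OF refl])
        fix p
        have "(\<Sum>q\<in>UNIV. (mat 1 :: 'k op) $ p $ q * (K p ** X ** adj (K q)) $ i $ j) =
          (\<Sum>q\<in>UNIV. if q = p then (K p ** X ** adj (K p)) $ i $ j else 0)"
          unfolding mat_def vec_lambda_beta by (intro sum.cong refl) auto
        then show "(\<Sum>q\<in>UNIV. (mat 1 :: 'k op) $ p $ q * (K p ** X ** adj (K q)) $ i $ j) =
          (K p ** X ** adj (K p)) $ i $ j" by simp
      qed
      ultimately show "J t x X = (\<chi> i j. \<Sum>p\<in>UNIV. \<Sum>q\<in>UNIV.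
        (mat 1 + op_smult (complex_of_real t) M) $ p $ q * (K p ** X ** adj (K q)) $ i $ j)"
        by (simp add: J_def \<Delta>_def vec_eq_iff distrib_right sum.distrib sum_distrib_left mult.assoc)
    qed
    then have "completely_positive (J t x)"
      using completely_positive_kraus_form[OF e(2)[OF t], of K] by simp
    moreover have "J t y = I y" if "y \<noteq> x" for y using that by (simp add: J_def fun_eq_iff)
    ultimately have "completely_positive (J t y)" for y
      using inst by (cases "y = x") (auto simp: is_instrument_def)
    moreover have "trace (\<Sum>y\<in>UNIV. J t y X) = trace X" for X
    proof -
      have "(\<Sum>y\<in>UNIV. J t y X) = (\<Sum>y\<in>UNIV. I y X) + op_smult (complex_of_real t) (\<Delta> X)"
        by (simp add: J_def sum.distrib)
      then show ?thesis using inst by (simp add: trace_add trace_op_smult tr\<Delta> is_instrument_def)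
    qed
    ultimately show ?thesis by (simp add: is_instrument_def)
  qed
  have "is_instrument (J e)" "is_instrument (J (- e))" using J e(1) by simp_all
  moreover have "I y X = op_smult (complex_of_real (1/2)) (J e y X)
      + op_smult (complex_of_real (1 - 1/2)) (J (- e) y X)" for y X
    by (simp add: J_def vec_eq_iff algebra_simps)
  moreover have "(0::real) < 1/2" "(1/2::real) < 1" by simp_all
  ultimately have "J e = I" using ext unfolding extremal_instrument_def by blast
  then have "J e x X = I x X" for X by simp
  then have "\<Delta> X = 0" for X using e(1) by (simp add: J_def vec_eq_iff)
  \<comment> \<open>On matrix units, \<open>\<Delta> = 0\<close> separates the entries of
    \<open>K p\<close> and \<open>K q\<close>. Independence is then used twice: once over
    \<open>p\<close>, and after conjugation once over \<open>q\<close>.\<close>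
  then have "\<Delta> (matrix_unit a b) $ i $ j = 0" for a b i j by simp
  then have zero: "(\<Sum>p\<in>UNIV. (\<Sum>q\<in>UNIV. M $ p $ q * cnj (K q $ j $ b)) * K p $ i $ a) = 0" for i j a b
    by (simp add: \<Delta>_def matrix_unit_conj_entry adj_entry sum_distrib_left sum_distrib_right mult_ac)
  have S_UNIV: "(\<Sum>k\<in>S. c k * K k $ i $ a) = (\<Sum>k\<in>UNIV. c k * K k $ i $ a)" for c i a
    by (rule sum.mono_neutral_left) (auto simp: K0)
  have "\<forall>p\<in>S. (\<Sum>q\<in>UNIV. M $ p $ q * cnj (K q $ j $ b)) = 0" for j b
    by (rule ind) (simp only: S_UNIV zero)
  then have "cnj (\<Sum>q\<in>UNIV. M $ p $ q * cnj (K q $ j $ b)) = 0" if "p \<in> S" for p j b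
    using that by simp
  then have zero': "(\<Sum>q\<in>UNIV. cnj (M $ p $ q) * K q $ j $ b) = 0" if "p \<in> S" for p j b
    using that by simp
  have "\<forall>q\<in>S. cnj (M $ p $ q) = 0" if "p \<in> S" for p
    by (rule ind) (simp only: S_UNIV zero'[OF that])
  with Mnz show False by simp
qed

text \<open>The columns of each \<open>K k\<close> lie in the span of the vectors of coefficients
  \<open>u k i b\<close>, one per \<open>b\<close>. If there are too few of them, some nonzero
  \<open>v\<close> is orthogonal to all, every \<open>adj (K k)\<close> kills it, and the form
  vanishes at \<open>v\<close>.\<close>

lemma dim_le_card_kraus_mult:
  fixes K :: "'k::finite \<Rightarrow> complex^'m^'n::finite"
  assumes pd: "positive_definite (\<Sum>k\<in>S. K k ** \<rho> ** adj (K k))"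
    and B: "finite B" "\<And>k i a. K k $ i $ a = (\<Sum>b\<in>B. u k i b * b $ a)"
  shows "CARD('n) \<le> card S * card B"
proof (rule ccontr)
  assume "\<not> CARD('n) \<le> card S * card B"
  then have "card (S \<times> B) < card (UNIV :: 'n set)" by (simp add: card_cartesian_product)
  from homogeneous_system_nontrivial[OF _ _ this, of "\<lambda>i kb. cnj (u (fst kb) i (snd kb))"] B(1)
  obtain c where c: "\<exists>i. c i \<noteq> 0" "\<And>k b. k \<in> S \<Longrightarrow> b \<in> B \<Longrightarrow> (\<Sum>i\<in>UNIV. c i * cnj (u k i b)) = 0"
    by auto
  define v where "v = (\<chi> i. c i)"
  have "v \<noteq> 0" using c(1) by (auto simp: v_def vec_eq_iff)
  have "adj (K k) *v v = 0" if "k \<in> S" for k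
  proof -
    have "(adj (K k) *v v) $ a = 0" for a
    proof -
      have "(adj (K k) *v v) $ a = (\<Sum>i\<in>UNIV. \<Sum>b\<in>B. cnj (b $ a) * (c i * cnj (u k i b)))"
        by (simp add: matrix_vector_mult_def adj_entry B(2) v_def sum_distrib_left sum_distrib_right mult_ac)
      also have "\<dots> = (\<Sum>b\<in>B. \<Sum>i\<in>UNIV. cnj (b $ a) * (c i * cnj (u k i b)))"
        by (rule sum.swap)
      also have "\<dots> = 0" using c(2)[OF that] by (simp flip: sum_distrib_left)
      finally show ?thesis .
    qed
    then show ?thesis by (simp add: vec_eq_iff)
  qed
  then have "qform (\<Sum>k\<in>S. K k ** \<rho> ** adj (K k)) v = 0"
    by (simp add: qform_sum qform_conj) (simp add: qform_def)
  with pd \<open>v \<noteq> 0\<close> show False by (auto simp: positive_definite_def)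
qed

text \<open>The channel sends a full-rank product state to a full-rank state. Compressing by a
  nonzero rank-one term of \<open>Z x\<close> stays strictly positive, since the product of nonzero
  vectors is nonzero; the other terms only add.\<close>

lemma third_law_outcome_positive_definite:
  fixes \<xi> :: "'a::finite op" and \<E> :: "('s::finite \<times> 'a) op \<Rightarrow> ('s \<times> 'a) op"
  assumes scheme: "third_law_scheme \<xi> \<E> Z" and "implements \<xi> \<E> Z I" and "Z x \<noteq> 0"
  shows "\<exists>\<rho>. positive_definite (I x \<rho>)"
proof -
  define r where "r = 1 / real CARD('s)"
  have r: "r > 0" by (simp add: r_def)
  \<comment> \<open>The maximally mixed state of the system.\<close>
  define \<rho> :: "'s op" where "\<rho> = op_smult (complex_of_real r) (mat 1)"
  have \<xi>: "positive_op \<xi>" "trace \<xi> = 1" "positive_definite \<xi>"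
    and Z: "positive_op (Z x)" and \<E>: "\<And>\<rho>. full_rank_state \<rho> \<Longrightarrow> full_rank_state (\<E> \<rho>)"
    using scheme by (auto simp: third_law_scheme_def measurement_scheme_def full_rank_state_def
        is_state_def third_law_channel_def)
  have q: "qform (tensor_op \<rho> \<xi>) v = complex_of_real r * (\<Sum>i\<in>UNIV. qform \<xi> (\<chi> j. v $ (i, j)))" for v
  proof -
    have "(tensor_op \<rho> \<xi> *v v) $ (i, j) = complex_of_real r * (\<xi> *v (\<chi> j. v $ (i, j))) $ j" for i j
    proof -
      have "(tensor_op \<rho> \<xi> *v v) $ (i, j) =
          (\<Sum>k\<in>UNIV. if k = i then complex_of_real r * (\<xi> *v (\<chi> j. v $ (i, j))) $ j else 0)"
        unfolding matrix_vector_mult_def sum_UNIV_pair vec_lambda_beta tensor_op_def \<rho>_def mat_def op_smult_def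
        by (intro sum.cong refl) (auto simp: sum_distrib_left mult_ac)
      then show ?thesis by simp
    qed
    then show ?thesis by (simp add: qform_def sum_UNIV_pair sum_distrib_left mult_ac)
  qed
  have pd: "Im (qform \<xi> w) = 0 \<and> (if w = 0 then Re (qform \<xi> w) = 0 else Re (qform \<xi> w) > 0)" for w
    using \<xi>(3) by (auto simp: positive_definite_def qform_def)
  have "positive_definite (tensor_op \<rho> \<xi>)"
    unfolding positive_definite_def
  proof (intro allI impI)
    fix v :: "complex^('s \<times> 'a)" assume "v \<noteq> 0"
    then obtain i j where "v $ (i, j) \<noteq> 0" by (auto simp: vec_eq_iff)
    then have "(\<chi> j. v $ (i, j)) \<noteq> 0" by (auto simp: vec_eq_iff)
    then have "Re (qform \<xi> (\<chi> j. v $ (i, j))) > 0" using pd[of "\<chi> j. v $ (i, j)"] by simp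
    moreover have "Re (qform \<xi> w) \<ge> 0" for w using pd[of w] by (auto split: if_splits)
    ultimately have "(\<Sum>i\<in>UNIV. Re (qform \<xi> (\<chi> j. v $ (i, j)))) > 0"
      by (intro sum_pos2[of _ i]) auto
    then show "Im (qform (tensor_op \<rho> \<xi>) v) = 0 \<and> 0 < Re (qform (tensor_op \<rho> \<xi>) v)"
      using r pd by (simp add: q)
  qed
  moreover have "positive_op A" if "positive_definite A" for A :: "('s \<times> 'a) op"
    unfolding positive_op_def
  proof
    fix v show "Im (qform A v) = 0 \<and> 0 \<le> Re (qform A v)"
      using that by (cases "v = 0") (auto simp: positive_definite_def qform_def less_imp_le)
  qed
  moreover have "trace \<rho> = 1"
    unfolding \<rho>_def trace_op_smult r_def by (simp add: trace_def mat_def)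
  then have "trace (tensor_op \<rho> \<xi>) = 1" by (simp add: trace_tensor \<xi>(2))
  ultimately have "full_rank_state (tensor_op \<rho> \<xi>)" by (simp add: full_rank_state_def is_state_def)
  then have Y: "positive_definite (\<E> (tensor_op \<rho> \<xi>))" using \<E> by (simp add: full_rank_state_def)
  obtain T :: "'a set" and z where z: "\<forall>i j. Z x $ i $ j = (\<Sum>m\<in>T. z m $ i * cnj (z m $ j))"
    using positive_op_gram[OF Z] by blast
  have Ix: "I x \<rho> = (\<Sum>m\<in>T. adj (tensor_vec (z m)) ** \<E> (tensor_op \<rho> \<xi>) ** tensor_vec (z m))"
    using assms(2) ptrace_kraus[of "Z x", OF z[rule_format]] by (simp add: implements_def)
  have q': "qform (I x \<rho>) v = (\<Sum>m\<in>T. qform (\<E> (tensor_op \<rho> \<xi>)) (tensor_vec (z m) *v v))" for v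
  proof -
    have "qform (adj (tensor_vec (z m)) ** Y ** tensor_vec (z m)) v = qform Y (tensor_vec (z m) *v v)" for m Y
      using qform_conj[of "adj (tensor_vec (z m))" Y v] by simp
    then show ?thesis by (simp add: Ix qform_sum)
  qed
  obtain m where m: "m \<in> T" "z m \<noteq> 0"
  proof -
    have "\<exists>m\<in>T. z m \<noteq> 0"
    proof (rule ccontr)
      assume "\<not> (\<exists>m\<in>T. z m \<noteq> 0)"
      then have "Z x = 0" by (simp add: vec_eq_iff z)
      with \<open>Z x \<noteq> 0\<close> show False ..
    qed
    then show ?thesis using that by blast
  qed
  have pdE: "Im (qform (\<E> (tensor_op \<rho> \<xi>)) w) = 0 \<and>
      (if w = 0 then Re (qform (\<E> (tensor_op \<rho> \<xi>)) w) = 0 else Re (qform (\<E> (tensor_op \<rho> \<xi>)) w) > 0)" for w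
    using Y by (auto simp: positive_definite_def qform_def)
  have "positive_definite (I x \<rho>)"
    unfolding positive_definite_def
  proof (intro allI impI)
    fix v :: "complex^'s" assume "v \<noteq> 0"
    then obtain i j where "v $ i \<noteq> 0" "z m $ j \<noteq> 0" using m by (auto simp: vec_eq_iff)
    then have "(tensor_vec (z m) *v v) $ (i, j) \<noteq> 0" by (simp add: tensor_vec_mult)
    then have "tensor_vec (z m) *v v \<noteq> 0" by (metis zero_index)
    then have "Re (qform (\<E> (tensor_op \<rho> \<xi>)) (tensor_vec (z m) *v v)) > 0"
      using pdE[of "tensor_vec (z m) *v v"] by simp
    moreover have "Re (qform (\<E> (tensor_op \<rho> \<xi>)) w) \<ge> 0" for w using pdE[of w] by (auto split: if_splits)
    ultimately have "(\<Sum>m\<in>T. Re (qform (\<E> (tensor_op \<rho> \<xi>)) (tensor_vec (z m) *v v))) > 0"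
      using m(1) by (intro sum_pos2[of _ m]) auto
    then show "Im (qform (I x \<rho>) v) = 0 \<and> 0 < Re (qform (I x \<rho>) v)"
      using pdE by (simp add: q')
  qed
  then show ?thesis by blast
qed

text \<open>The outcome probability in a pure state \<open>w\<close> is both the form of
  \<open>E x\<close> at \<open>w\<close> and the sum of the squared norms of
  \<open>K k *v w\<close>; if it is zero, so is each summand.\<close>

lemma effect_kernel_le_kraus_kernel:
  fixes K :: "'k::finite \<Rightarrow> complex^'n::finite^'n"
  assumes "is_E_instrument E I" "\<And>X. I x X = (\<Sum>k\<in>S. K k ** X ** adj (K k))"
    "E x *v v = 0" "k \<in> S"
  shows "K k *v v = 0"
proof (cases "v = 0")
  case False
  \<comment> \<open>Normalised, because the probability rule of an \<open>E\<close>-instrument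
    speaks of states only.\<close>
  define w where "w = (1 / norm v) *\<^sub>R v"
  have "norm w = 1" using False by (simp add: w_def)
  have "qform (E x) v = 0" using assms(3) by (simp add: qform_def)
  then have "qform (E x) w = 0" by (simp add: w_def qform_scaleR)
  then have "trace (I x (proj w)) = 0"
    using assms(1) is_state_proj[OF \<open>norm w = 1\<close>] by (simp add: is_E_instrument_def trace_mult_proj)
  moreover have "trace (K k ** proj w ** adj (K k)) = complex_of_real ((norm (K k *v w))\<^sup>2)" for k
  proof -
    have "trace (K k ** proj w ** adj (K k)) = trace ((adj (K k) ** K k) ** proj w)"
      using trace_mul_sym[of "K k ** proj w" "adj (K k)"] by (simp add: matrix_mul_assoc)
    also have "\<dots> = cip (K k *v w) (K k *v w)"
      by (simp add: trace_mult_proj qform_cip cip_adj flip: matrix_vector_mul_assoc)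
    finally show ?thesis by (simp add: cip_self)
  qed
  moreover have "trace (\<Sum>k\<in>S. A k) = (\<Sum>k\<in>S. trace (A k))" for A :: "'k \<Rightarrow> 'n op"
    unfolding trace_def sum_component by (rule sum.swap)
  ultimately have "complex_of_real (\<Sum>k\<in>S. (norm (K k *v w))\<^sup>2) = 0" by (simp add: assms(2))
  then have "(\<Sum>k\<in>S. (norm (K k *v w))\<^sup>2) = 0" by (simp only: of_real_eq_0_iff)
  then have "K k *v w = 0" using \<open>k \<in> S\<close> by (simp add: sum_nonneg_eq_0_iff)
  then show ?thesis using False by (simp add: w_def linear_scale[OF matrix_vector_mul_linear])
qed simp

lemma extremal_rank_bound:
  fixes \<xi> :: "'a::finite op" and \<E> :: "('s::finite \<times> 'a) op \<Rightarrow> ('s \<times> 'a) op"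
  assumes scheme: "third_law_scheme \<xi> \<E> Z" and obs: "is_observable E" and inst: "is_E_instrument E I"
    and impl: "implements \<xi> \<E> Z I" and ext: "extremal_instrument I"
  shows "CARD('s) \<le> rank (E x) * rank (E x)"
proof -
  have I_def: "I = (\<lambda>x \<rho>. ptrace_A (tensor_op (mat 1) (Z x) ** \<E> (tensor_op \<rho> \<xi>)))"
    using impl by (simp add: implements_def fun_eq_iff)
  have "is_instrument I"
    unfolding I_def using scheme by (intro instrument_of_scheme) (simp add: third_law_scheme_def)
  \<comment> \<open>A zero pointer effect would force \<open>E x = 0\<close>, which an observable
    excludes.\<close>
  have "Z x \<noteq> 0"
  proof
    assume "Z x = 0"
    then have "I x \<rho> = 0" for \<rho>
      by (simp add: I_def vec_eq_iff ptrace_A_def tensor_mat_1_mult)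
    then have I0: "trace (I x \<rho>) = trace (0 ** \<rho>)" for \<rho>
      by (simp add: trace_def matrix_matrix_mult_def)
    have "E x = 0"
    proof (rule op_eq_if_trace_states_eq)
      fix \<rho> :: "'s op" assume "is_state \<rho>"
      then have "trace (E x ** \<rho>) = trace (I x \<rho>)" using inst by (simp add: is_E_instrument_def)
      then show "trace (E x ** \<rho>) = trace (0 ** \<rho>)" by (simp only: I0)
    qed
    with obs show False by (simp add: is_observable_def)
  qed
  have cp: "completely_positive (I x)" using inst by (simp add: is_E_instrument_def)
  show ?thesis
  proof (rule kraus_decomposition[OF cp], goal_cases)
    case (1 K S)
    note K = 1(1) and K0 = 1(2) and ind = 1(3)
    obtain B where B: "vec.independent B" "rows (E x) \<subseteq> vec.span B" "card B = rank (E x)"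
      unfolding row_rank_def_gen using vec.basis_exists[of "rows (E x)"] by metis
    have fB: "finite B" using B(1) by (rule vec.finiteI_independent)
    \<comment> \<open>A row outside the row space of \<open>E x\<close> would be detected by a
      vector in the kernel of \<open>E x\<close>, which every Kraus operator kills. For
      \<open>k\<close> off \<open>S\<close> the rows are zero.\<close>
    have "\<exists>r. K k $ i = (\<Sum>b\<in>B. r b *s b)" for k i
    proof -
      have "K k $ i \<in> vec.span (rows (E x))"
      proof (rule ccontr)
        assume "K k $ i \<notin> vec.span (rows (E x))"
        then obtain v where v: "E x *v v = 0" "(\<Sum>a\<in>UNIV. K k $ i $ a * v $ a) \<noteq> 0"
          by (rule kernel_vector_off_row_space)
        then have "(K k *v v) $ i \<noteq> 0" by (simp add: matrix_vector_mult_def)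
        moreover have "K k *v v = 0"
          using effect_kernel_le_kraus_kernel[OF inst K v(1)] K0[of k] by (cases "k \<in> S") auto
        ultimately show False by simp
      qed
      also have "\<dots> \<subseteq> vec.span B" using B(2) by (rule vec.span_minimal) (rule vec.subspace_span)
      finally show ?thesis using fB by (auto simp: vec.span_finite)
    qed
    then obtain u where "\<And>k i. K k $ i = (\<Sum>b\<in>B. u k i b *s b)" by metis
    then have u: "K k $ i $ a = (\<Sum>b\<in>B. u k i b * b $ a)" for k i a by simp
    have "card S \<le> card B"
      by (rule extremal_card_kraus_le[OF \<open>is_instrument I\<close> ext K K0 ind fB u])
    moreover obtain \<rho> where "positive_definite (I x \<rho>)"
      using third_law_outcome_positive_definite[OF scheme impl \<open>Z x \<noteq> 0\<close>] by blast
    then have "CARD('s) \<le> card S * card B"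
      unfolding K by (rule dim_le_card_kraus_mult[OF _ fB u])
    ultimately show ?case using B(3) by (metis le_trans mult_le_mono1)
  qed
qed

theorem theorem5:
  fixes \<xi> :: "'a::finite op"
    and \<E> :: "('s::finite \<times> 'a) op \<Rightarrow> ('s \<times> 'a) op"
    and Z :: "'x::finite \<Rightarrow> 'a op"
    and E :: "'x \<Rightarrow> 's op"
    and I :: "'x \<Rightarrow> 's op \<Rightarrow> 's op"
  assumes "CARD('s) \<ge> 2"
    and "third_law_scheme \<xi> \<E> Z"
    and "nontrivial_observable E"
    and "is_E_instrument E I"
    and "implements \<xi> \<E> Z I"
    and "extremal_instrument I"
  shows "(\<forall>x. real (rank (E x)) \<ge> sqrt (real CARD('s)))
       \<and> \<not> (\<exists>U. unitary_op U \<and> (\<forall>X. \<E> X = U ** X ** adj U))"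
proof (intro conjI allI notI)
  fix x
  have "real CARD('s) \<le> real (rank (E x) * rank (E x))"
    using assms extremal_rank_bound[of \<xi> \<E> Z E I x]
    unfolding nontrivial_observable_def by (intro of_nat_mono) blast
  then have "sqrt (real CARD('s)) \<le> sqrt ((real (rank (E x)))\<^sup>2)"
    by (intro real_sqrt_le_mono) (simp add: power2_eq_square)
  then show "real (rank (E x)) \<ge> sqrt (real CARD('s))" by simp
next
  assume "\<exists>U. unitary_op U \<and> (\<forall>X. \<E> X = U ** X ** adj U)"
  then show False using extremal_not_unitary[OF assms(2-6)] by blast
qed

end
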